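(* Let $n \geq 5$ and let $\vec{\alpha}=(\alpha_1,\dots,\alpha_n) \in \mathbb{R}^n$ satisfy $\alpha_j^{-1} = q_j + \alpha q_j^2$ for all $1\le j\le n$, for some $\alpha\in\mathbb{R}$ and some $\vec{q} \in \mathbb{Q}^n$ with distinct, non-zero entries such that $q_j \alpha \neq -1$ for all $1 \leq j \leq n$. Let $\Gamma^{\vec\alpha}=\{\vec\xi\in\mathbb{R}^n:\sum_{j=1}^n\xi_j\alpha_j=0\}$. Then there exists $m \in \mathcal{M}_{\Gamma^{\vec{\alpha}}}(\mathbb{R}^n)$, supported in $\{ \vec{\xi}: \mathrm{dist}(\vec{\xi}, \Gamma^{\vec{\alpha}}) \le C\}$ for some constant $C$, such that $T_m$ satisfies no $L^p$ estimates.
   Context: For a subspace $\Gamma\subset\mathbb{R}^n$, $\mathcal{M}_\Gamma(\mathbb{R}^n)$ is the set of functions $m:\mathbb{R}^n\to\mathbb{R}$ such that for every multi-index $\vec\gamma\in(\mathbb{N}\cup\{0\})^n$ there is $C_{\vec\gamma}$ with $|\partial^{\vec\gamma}m(\vec\xi)|\le C_{\vec\gamma}\,\mathrm{dist}(\vec\xi,\Gamma)^{-|\vec\gamma|}$ (for $\vec\xi\notin\Gamma$). For $m\in L^\infty(\mathbb{R}^n)$, $T_m$ is the operator defined a priori on $n$-tuples of Schwartz functions by $T_m(f_1,\dots,f_n)(x)=\int_{\mathbb{R}^n}m(\vec\xi)\big[\prod_{j=1}^n\hat f_j(\xi_j)e^{2\pi i x\xi_j}\big]d\vec\xi$, where $\hat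 f(\xi)=\int_{\mathbb{R}} f(x)e^{-2\pi i x\xi}dx$. An $n$-linear operator $T$ defined a priori on $\mathcal{S}(\mathbb{R})^n$ "satisfies no $L^p$ estimates" if there is no $n$-tuple $(p_1,\dots,p_n)\in[1,\infty]^n$ for which there is a constant $C$ such that $\|T(\vec f)\|_p\le C\prod_{j=1}^n\|f_j\|_{p_j}$ for all $\vec f\in\mathcal{S}(\mathbb{R})^n$, where $\frac1p=\sum_{j=1}^n\frac1{p_j}$ (with $1/\infty=0$). *)

theory Defs
  imports "HOL-Analysis.Analysis" "HOL-Probability.Essential_Supremum"
begin

section \<open>Mihlin-type multipliers adapted to a subspace\<close>

definition partial_deriv :: "'n \<Rightarrow> (real ^ 'n \<Rightarrow> real) \<Rightarrow> (real ^ 'n \<Rightarrow> real)" where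
  "partial_deriv j g = (\<lambda>\<xi>. deriv (\<lambda>t. g (\<xi> + t *\<^sub>R axis j 1)) 0)"

definition iterated_partial :: "'n list \<Rightarrow> (real ^ 'n \<Rightarrow> real) \<Rightarrow> (real ^ 'n \<Rightarrow> real)" where
  "iterated_partial js g = foldr partial_deriv js g"

text \<open>Meant for open \<open>S\<close>: differentiability of all iterated partial derivatives is then
  \<open>C\<^sup>\<infinity>\<close> smoothness on \<open>S\<close>.\<close>

definition smooth_function_on :: "(real ^ 'n) set \<Rightarrow> (real ^ 'n \<Rightarrow> real) \<Rightarrow> bool" where
  "smooth_function_on S g \<longleftrightarrow>
     (\<forall>js. \<forall>\<xi>\<in>S. iterated_partial js g differentiable (at \<xi>))"

text \<open>The derivative for the multi-index \<open>\<gamma>\<close> differentiates \<open>\<gamma> j\<close> times in the \<open>j\<close>-th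
  coordinate. The index type carries no order, so some order of differentiation is picked; where
  \<open>g\<close> is smooth the result does not depend on it, by the symmetry of mixed partial
  derivatives.\<close>

definition multi_deriv :: "('n \<Rightarrow> nat) \<Rightarrow> (real ^ 'n::finite \<Rightarrow> real) \<Rightarrow> (real ^ 'n \<Rightarrow> real)" where
  "multi_deriv \<gamma> g = iterated_partial (SOME js. \<forall>j. count_list js j = \<gamma> j) g"

definition adapted_multipliers :: "(real ^ 'n::finite) set \<Rightarrow> (real ^ 'n \<Rightarrow> real) set" where
  "adapted_multipliers \<Gamma> =
     {m. smooth_function_on (- \<Gamma>) m \<and>
         (\<forall>\<gamma>. \<exists>C. \<forall>\<xi>. \<xi> \<notin> \<Gamma> \<longrightarrow> \<bar>multi_deriv \<gamma> m \<xi>\<bar> \<le> C / infdist \<xi> \<Gamma> ^ (\<Sum>j\<in>UNIV. \<gamma> j))}"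

section \<open>Schwartz functions and the Fourier transform\<close>

definition iterated_deriv :: "nat \<Rightarrow> (real \<Rightarrow> complex) \<Rightarrow> (real \<Rightarrow> complex)" where
  "iterated_deriv k f = ((\<lambda>g x. vector_derivative g (at x)) ^^ k) f"

definition schwartz :: "(real \<Rightarrow> complex) set" where
  "schwartz = {f. (\<forall>k x. iterated_deriv k f differentiable (at x)) \<and>
                  (\<forall>k l. bounded (range (\<lambda>x. x ^ l *\<^sub>R iterated_deriv k f x)))}"

definition fourier :: "(real \<Rightarrow> complex) \<Rightarrow> real \<Rightarrow> complex" where
  "fourier f \<xi> = (LINT x|lebesgue. f x * exp (- 2 * of_real pi * \<i> * of_real x * of_real \<xi>))"

section \<open>Multilinear multiplier operators and their estimates\<close>

definition multiplier_op ::
  "(real ^ 'n::finite \<Rightarrow> real) \<Rightarrow> ('n \<Rightarrow> real \<Rightarrow> complex) \<Rightarrow> real \<Rightarrow> complex" where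
  "multiplier_op m f x =
     (LINT \<xi>|lebesgue. of_real (m \<xi>) *
        (\<Prod>j\<in>UNIV. fourier (f j) (\<xi> $ j) * exp (2 * of_real pi * \<i> * of_real x * of_real (\<xi> $ j))))"

text \<open>The exponent ranges over \<open>0 < p \<le> \<infinity>\<close>; for \<open>p < 1\<close> this is only a quasi-norm.\<close>

definition Lp_norm :: "ennreal \<Rightarrow> (real \<Rightarrow> complex) \<Rightarrow> ennreal" where
  "Lp_norm p f =
     (if p = \<infinity> then esssup lebesgue (\<lambda>x. ennreal (cmod (f x)))
      else let I = (\<integral>\<^sup>+x. ennreal (cmod (f x) powr enn2real p) \<partial>lebesgue)
           in if I = \<infinity> then \<infinity> else ennreal (enn2real I powr (1 / enn2real p)))"

text \<open>In \<^typ>\<open>ennreal\<close> we have \<open>inverse \<infinity> = 0\<close> and \<open>inverse 0 = \<infinity>\<close>, so the target exponent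
  below is the \<open>p\<close> with \<open>1/p = \<Sum>\<^sub>j 1/p\<^sub>j\<close>, including \<open>p = \<infinity>\<close> when every \<open>p\<^sub>j = \<infinity>\<close>. The norms
  are extended-valued, so an output with infinite norm violates the estimate.\<close>

definition satisfies_no_Lp_estimates :: "(('n::finite \<Rightarrow> real \<Rightarrow> complex) \<Rightarrow> real \<Rightarrow> complex) \<Rightarrow> bool" where
  "satisfies_no_Lp_estimates T \<longleftrightarrow>
     \<not> (\<exists>p :: 'n \<Rightarrow> ennreal. (\<forall>j. 1 \<le> p j) \<and>
          (\<exists>C :: real. \<forall>f. (\<forall>j. f j \<in> schwartz) \<longrightarrow>
             Lp_norm (inverse (\<Sum>j\<in>UNIV. inverse (p j))) (T f)
               \<le> ennreal C * (\<Prod>j\<in>UNIV. Lp_norm (p j) (f j))))"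

end

theory Submission
  imports Defs "HOL-Probability.Probability"
begin

text \<open>The symbol \<open>m\<close> is a sum of disjoint smooth bumps of unit size, centred at those integer points
  \<open>k\<close> with \<open>\<Sum>\<^sub>j k\<^sub>j = 0\<close> and \<open>\<bar>\<Sum>\<^sub>j \<alpha>\<^sub>j k\<^sub>j\<bar> \<le> 1\<close>, with coefficient \<open>\<Prod>\<^sub>j r \<bar>k\<^sub>j\<bar>\<close> for the Rudin--Shapiro signs
  \<open>r\<close>. Since the bumps stay within a bounded distance of the hyperplane, bounded derivatives suffice
  for the Mihlin condition.

  Test with \<open>f\<^sub>j\<close> a wide Gaussian times the trigonometric polynomial with coefficients \<open>r \<bar>k\<bar>\<close>,
  \<open>\<bar>k\<bar> < N\<close>. Rudin--Shapiro polynomials are flat, so \<open>f\<^sub>j\<close> is \<open>O(N\<^bsup>1/2\<^esup>)\<close> times the Gaussian, while in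
  the output all signs cancel and all frequencies are zero: it is a Gaussian times
  the number of admissible \<open>k\<close>, which is at least a multiple of \<open>N\<^bsup>n-2\<^esup>\<close> by pigeonhole. As the
  Gaussians have the same width, their norms cancel for every choice of exponents, and
  \<open>n - 2 > n / 2\<close> for \<open>n \<ge> 5\<close>.\<close>

section \<open>Rudin--Shapiro polynomials\<close>

text \<open>The sign is -1 to the number of adjacent pairs of ones in the binary expansion of
  \<open>n\<close>: the exponent is odd exactly when the last two digits are both one.\<close>

fun rudin_shapiro :: "nat \<Rightarrow> real" where
  "rudin_shapiro n =
     (if n = 0 then 1 else (-1) ^ (n mod 2 * (n div 2)) * rudin_shapiro (n div 2))"

declare rudin_shapiro.simps [simp del]

lemma rudin_shapiro_double: "rudin_shapiro (2 * k) = rudin_shapiro k"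
  by (cases "k = 0") (simp_all add: rudin_shapiro.simps [of "2 * k"])

lemma rudin_shapiro_Suc_double: "rudin_shapiro (Suc (2 * k)) = (-1) ^ k * rudin_shapiro k"
  by (simp add: rudin_shapiro.simps [of "Suc (2 * k)"])

lemma rudin_shapiro_0 [simp]: "rudin_shapiro 0 = 1"
  by (simp add: rudin_shapiro.simps [of 0])

lemma rudin_shapiro_square [simp]: "rudin_shapiro n * rudin_shapiro n = 1"
proof (induction n rule: less_induct)
  case (less n)
  show ?case
  proof (cases "n = 0")
    case False
    define e :: real where "e = (-1) ^ (n mod 2 * (n div 2))"
    have "e * e = 1" unfolding e_def by (metis left_minus_one_mult_self mult.right_neutral)
    moreover have "rudin_shapiro n = e * rudin_shapiro (n div 2)"
      using False by (simp add: e_def rudin_shapiro.simps [of n])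
    moreover have "rudin_shapiro (n div 2) * rudin_shapiro (n div 2) = 1"
      using False by (intro less) simp
    ultimately show ?thesis by (simp add: algebra_simps)
  qed simp
qed

lemma abs_rudin_shapiro [simp]: "\<bar>rudin_shapiro n\<bar> = 1"
proof -
  have "rudin_shapiro n = 1 \<or> rudin_shapiro n = -1"
    using rudin_shapiro_square [of n] by (simp only: square_eq_1_iff)
  then show ?thesis by auto
qed

definition rudin_shapiro_poly :: "nat \<Rightarrow> complex \<Rightarrow> complex" where
  "rudin_shapiro_poly m z = (\<Sum>k<2 ^ m. of_real (rudin_shapiro k) * z ^ k)"

lemma sum_lessThan_double:
  fixes f :: "nat \<Rightarrow> 'a::comm_monoid_add"
  shows "(\<Sum>k<2 * n. f k) = (\<Sum>k<n. f (2 * k) + f (Suc (2 * k)))"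
  by (induction n) (simp_all add: add.assoc)

text \<open>Splitting into even and odd exponents leaves polynomials in \<open>z\<^sup>2\<close>;
  the sign \<open>(-1) ^ k\<close> at odd exponents moves into the argument, giving
  \<open>- (z\<^sup>2)\<close>.\<close>

lemma rudin_shapiro_poly_Suc:
  "rudin_shapiro_poly (Suc m) z = rudin_shapiro_poly m (z\<^sup>2) + z * rudin_shapiro_poly m (- (z\<^sup>2))"
proof -
  let ?r = "\<lambda>k. complex_of_real (rudin_shapiro k)"
  have even: "?r (2 * k) * z ^ (2 * k) = ?r k * (z\<^sup>2) ^ k" for k
    by (simp only: rudin_shapiro_double power_mult)
  have odd: "?r (Suc (2 * k)) * z ^ Suc (2 * k) = z * (?r k * (- (z\<^sup>2)) ^ k)" for k
    unfolding rudin_shapiro_Suc_double power_minus [of "z\<^sup>2"] power_Suc power_mult [of z 2]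
      of_real_mult of_real_power of_real_minus of_real_1
    by (simp only: mult_ac)
  show ?thesis
    by (simp only: rudin_shapiro_poly_def power_Suc [of "2::nat"] sum_lessThan_double even odd
        sum.distrib sum_distrib_left)
qed

text \<open>On the unit circle the values at \<open>z\<close> and \<open>- z\<close> are the sum and
  the difference of two numbers whose moduli are those of the previous polynomial at
  \<open>z\<^sup>2\<close> and \<open>- (z\<^sup>2)\<close>, so the parallelogram law doubles the
  total at each step.\<close>

lemma rudin_shapiro_poly_parallelogram:
  assumes "cmod z = 1"
  shows "(cmod (rudin_shapiro_poly m z))\<^sup>2 + (cmod (rudin_shapiro_poly m (- z)))\<^sup>2 = 2 ^ Suc m"
  using assms
proof (induction m arbitrary: z)
  case 0
  then show ?case by (simp add: rudin_shapiro_poly_def)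
next
  case (Suc m)
  define a b where "a = rudin_shapiro_poly m (z\<^sup>2)" and "b = z * rudin_shapiro_poly m (- (z\<^sup>2))"
  have "rudin_shapiro_poly (Suc m) z = a + b"
    by (simp only: rudin_shapiro_poly_Suc a_def b_def)
  moreover have "rudin_shapiro_poly (Suc m) (- z) = a - b"
    by (simp only: rudin_shapiro_poly_Suc a_def b_def power2_minus mult_minus_left
        diff_conv_add_uminus)
  moreover have "(cmod (a + b))\<^sup>2 + (cmod (a - b))\<^sup>2 = 2 * ((cmod a)\<^sup>2 + (cmod b)\<^sup>2)"
    by (simp only: cmod_power2 plus_complex.sel minus_complex.sel) algebra
  moreover have "(cmod a)\<^sup>2 + (cmod b)\<^sup>2 = 2 ^ Suc m"
  proof -
    have "cmod (z\<^sup>2) = 1" by (simp add: norm_power Suc.prems)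
    note Suc.IH [OF this]
    moreover have "cmod b = cmod (rudin_shapiro_poly m (- (z\<^sup>2)))"
      by (simp only: b_def norm_mult Suc.prems mult_1)
    ultimately show ?thesis by (simp only: a_def)
  qed
  ultimately show ?case by (simp only: power_Suc)
qed

text \<open>Dropping the term at \<open>- z\<close> from the identity gives flatness: the maximum on
  the circle is at most \<open>sqrt 2\<close> times the mean-square norm
  \<open>sqrt (2 ^ m)\<close>.\<close>

lemma cmod_rudin_shapiro_poly_le:
  assumes "cmod z = 1"
  shows "cmod (rudin_shapiro_poly m z) \<le> sqrt (2 * 2 ^ m)"
proof (rule real_le_rsqrt)
  show "(cmod (rudin_shapiro_poly m z))\<^sup>2 \<le> 2 * 2 ^ m"
    using rudin_shapiro_poly_parallelogram [OF assms, of m]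
      zero_le_power2 [of "cmod (rudin_shapiro_poly m (- z))"]
    unfolding power_Suc by linarith
qed

text \<open>Non-negative frequencies give the polynomial at \<open>z\<close>, negative ones the
  polynomial at \<open>inverse z\<close>, again on the circle. Frequency 0 is then counted twice and
  subtracted once; the constant 4 absorbs both factors \<open>sqrt 2\<close> and this 1.\<close>

lemma cmod_symmetric_rudin_shapiro_le:
  assumes "cmod z = 1"
  shows "cmod (\<Sum>k | \<bar>k\<bar> < 2 ^ m. of_real (rudin_shapiro (nat \<bar>k\<bar>)) * z powi k) \<le> 4 * sqrt (2 ^ m)"
proof -
  let ?c = "\<lambda>k. of_real (rudin_shapiro (nat \<bar>k\<bar>)) * z powi k"
  have split: "{k::int. \<bar>k\<bar> < 2 ^ m} = {0..<2 ^ m} \<union> {- (2 ^ m)<..<0}"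
    by auto
  have pos: "(\<Sum>k\<in>{0..<2 ^ m}. ?c k) = rudin_shapiro_poly m z"
    unfolding rudin_shapiro_poly_def
  proof (rule sum.reindex_bij_witness [of _ int nat])
    fix k :: int assume "k \<in> {0..<2 ^ m}"
    then show "of_real (rudin_shapiro (nat k)) * z ^ nat k = ?c k" "nat k \<in> {..<2 ^ m}"
      by (simp_all add: power_int_def nat_less_iff)
  qed (simp_all)
  have "(\<Sum>k\<in>{- (2 ^ m)<..<0}. ?c k)
      = (\<Sum>k\<in>{..<2 ^ m} - {0}. of_real (rudin_shapiro k) * inverse z ^ k)"
  proof (rule sum.reindex_bij_witness [of _ "\<lambda>k. - int k" "\<lambda>k. nat (- k)"])
    fix k :: int assume "k \<in> {- (2 ^ m)<..<0}"
    then show "of_real (rudin_shapiro (nat (- k))) * inverse z ^ nat (- k) = ?c k"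
        "nat (- k) \<in> {..<2 ^ m} - {0}"
      by (simp_all add: power_int_def nat_less_iff)
  next
    fix k :: nat assume "k \<in> {..<2 ^ m} - {0}"
    then have "k > 0" "int k < 2 ^ m" by auto
    then show "- int k \<in> {- (2 ^ m)<..<0}" by simp
  qed simp_all
  also have "\<dots> = rudin_shapiro_poly m (inverse z) - 1"
    by (simp add: rudin_shapiro_poly_def sum_diff1)
  finally have neg: "(\<Sum>k\<in>{- (2 ^ m)<..<0}. ?c k) = rudin_shapiro_poly m (inverse z) - 1" .
  have "(\<Sum>k | \<bar>k\<bar> < 2 ^ m. ?c k) = rudin_shapiro_poly m z + (rudin_shapiro_poly m (inverse z) - 1)"
    unfolding split pos [symmetric] neg [symmetric] by (rule sum.union_disjoint) auto
  then have "cmod (\<Sum>k | \<bar>k\<bar> < 2 ^ m. ?c k)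
      \<le> cmod (rudin_shapiro_poly m z) + (cmod (rudin_shapiro_poly m (inverse z)) + 1)"
    using norm_triangle_ineq [of "rudin_shapiro_poly m z" "rudin_shapiro_poly m (inverse z) - 1"]
      norm_triangle_ineq4 [of "rudin_shapiro_poly m (inverse z)" 1]
    by simp
  also have "\<dots> \<le> sqrt (2 * 2 ^ m) + (sqrt (2 * 2 ^ m) + 1)"
    using assms by (intro add_mono cmod_rudin_shapiro_poly_le order_refl) (simp_all add: norm_inverse)
  also have "\<dots> \<le> 4 * sqrt (2 ^ m)"
  proof -
    have "sqrt 2 \<le> 3 / 2" by (rule real_le_lsqrt) (auto simp: power2_eq_square)
    then have "sqrt 2 * sqrt (2 ^ m) \<le> 3 / 2 * sqrt (2 ^ m)"
      by (intro mult_right_mono) auto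
    moreover have "1 \<le> sqrt (2 ^ m)" by simp
    ultimately show ?thesis unfolding real_sqrt_mult by linarith
  qed
  finally show ?thesis .
qed

section \<open>Counting small lattice points\<close>

text \<open>Pigeonhole on the values of the two linear forms over the cube; differences of points in one
  cell are small lattice points.\<close>

lemma card_small_lattice_points:
  fixes \<alpha> :: "real ^ 'n::finite"
  obtains c :: real where "c > 0"
    "\<And>N::nat. N > 0 \<Longrightarrow> c * real N ^ CARD('n) \<le> real N ^ 2 *
       real (card {k::'n \<Rightarrow> int. (\<forall>j. \<bar>k j\<bar> < int N) \<and> (\<Sum>j\<in>UNIV. k j) = 0 \<and>
                     \<bar>\<Sum>j\<in>UNIV. \<alpha> $ j * of_int (k j)\<bar> \<le> 1})"
proof
  define n where "n = CARD('n)"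
  define S where "S = nat \<lceil>\<Sum>j\<in>UNIV. \<bar>\<alpha> $ j\<bar>\<rceil>"
  have n: "n > 0" by (simp add: n_def)
  have S: "(\<Sum>j\<in>UNIV. \<bar>\<alpha> $ j\<bar>) \<le> real S"
    unfolding S_def by linarith
  show "0 < 1 / (real n * (2 * real S + 1))" using n by simp
  fix N :: nat assume N: "N > 0"
  let ?K = "{k::'n \<Rightarrow> int. (\<forall>j. \<bar>k j\<bar> < int N) \<and> (\<Sum>j\<in>UNIV. k j) = 0 \<and>
                     \<bar>\<Sum>j\<in>UNIV. \<alpha> $ j * of_int (k j)\<bar> \<le> 1}"
  define U where "U = (UNIV::'n set) \<rightarrow>\<^sub>E {0..<int N}"
  \<comment> \<open>The sums take at most \<open>n * N\<close> values and the floors at most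
    \<open>2 * S * N + 1\<close>, so the \<open>N ^ n\<close> points fall into only O(N^2)
    cells.\<close>
  define V where "V = {0..<int (n * N)} \<times> {- int (S * N)..int (S * N)}"
  define g where "g u = ((\<Sum>j\<in>UNIV. u j), \<lfloor>\<Sum>j\<in>UNIV. \<alpha> $ j * of_int (u j)\<rfloor>)" for u :: "'n \<Rightarrow> int"
  have finU: "finite U" by (simp add: U_def finite_PiE)
  have cardU: "card U = N ^ n"
    by (simp add: U_def card_PiE n_def)
  have cardV: "card V = n * N * (2 * (S * N) + 1)"
    by (simp add: V_def card_cartesian_product nat_mult_distrib nat_add_distrib algebra_simps
        flip: of_nat_mult)
  have gUV: "g \<in> U \<rightarrow> V"
  proof
    fix u assume u: "u \<in> U"
    then have uj: "0 \<le> u j" "u j < int N" for j by (auto simp: U_def)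
    have "(\<Sum>j\<in>UNIV. u j) < (\<Sum>j\<in>(UNIV::'n set). int N)"
      by (rule sum_strict_mono) (auto simp: uj)
    moreover have "0 \<le> (\<Sum>j\<in>UNIV. u j)" by (simp add: sum_nonneg uj)
    moreover have "\<bar>\<Sum>j\<in>UNIV. \<alpha> $ j * of_int (u j)\<bar> \<le> real (S * N)"
    proof -
      have "\<bar>\<Sum>j\<in>UNIV. \<alpha> $ j * of_int (u j)\<bar> \<le> (\<Sum>j\<in>UNIV. \<bar>\<alpha> $ j\<bar> * real N)"
      proof (rule order_trans [OF sum_abs sum_mono])
        fix j
        have "\<bar>real_of_int (u j)\<bar> \<le> real N" using uj [of j] by linarith
        then show "\<bar>\<alpha> $ j * of_int (u j)\<bar> \<le> \<bar>\<alpha> $ j\<bar> * real N"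
          by (simp add: abs_mult mult_left_mono)
      qed
      also have "\<dots> \<le> real S * real N"
        unfolding sum_distrib_right [symmetric] by (intro mult_right_mono S) simp
      finally show ?thesis by simp
    qed
    ultimately show "g u \<in> V"
      unfolding g_def V_def by (auto simp: n_def abs_le_iff le_floor_iff floor_le_iff)
  qed
  have "V \<noteq> {}" using n N by (auto simp: V_def)
  then obtain y where y: "card U \<le> card (g -` {y} \<inter> U) * card V"
    using pigeonhole_card [OF gUV finU] by (auto simp: V_def)
  have le: "card (g -` {y} \<inter> U) \<le> card ?K"
  proof (cases "g -` {y} \<inter> U = {}")
    case False
    \<comment> \<open>Subtracting one fixed point of the cell is injective and maps the whole cell
      into the set to be counted.\<close>
    then obtain v where v: "v \<in> U" "g v = y" by auto
    have finK: "finite ?K"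
    proof (rule finite_subset)
      show "?K \<subseteq> UNIV \<rightarrow>\<^sub>E {- int N..int N}" by (force simp: abs_less_iff less_imp_le minus_le_iff)
    qed (simp add: finite_PiE)
    show ?thesis
    proof (rule card_inj_on_le [OF _ _ finK])
      show "inj_on (\<lambda>u j. u j - v j) (g -` {y} \<inter> U)"
        by (auto simp: inj_on_def fun_eq_iff)
      show "(\<lambda>u j. u j - v j) ` (g -` {y} \<inter> U) \<subseteq> ?K"
      proof (rule image_subsetI)
        fix u assume "u \<in> g -` {y} \<inter> U"
        then have u: "u \<in> U" "y = g u" by auto
        have "(\<Sum>j\<in>UNIV. u j) = (\<Sum>j\<in>UNIV. v j)"
          and fl: "\<lfloor>\<Sum>j\<in>UNIV. \<alpha> $ j * of_int (u j)\<rfloor> = \<lfloor>\<Sum>j\<in>UNIV. \<alpha> $ j * of_int (v j)\<rfloor>"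
          using u v by (auto simp: g_def)
        moreover have "\<bar>u j - v j\<bar> < int N" for j
        proof -
          have "0 \<le> u j \<and> u j < int N \<and> 0 \<le> v j \<and> v j < int N"
            using u v by (auto simp: U_def)
          then show ?thesis by (simp add: abs_less_iff)
        qed
        moreover have "\<bar>(\<Sum>j\<in>UNIV. \<alpha> $ j * of_int (u j)) - (\<Sum>j\<in>UNIV. \<alpha> $ j * of_int (v j))\<bar> \<le> 1"
          using fl by linarith
        ultimately show "(\<lambda>j. u j - v j) \<in> ?K"
          by (simp add: sum_subtractf right_diff_distrib)
      qed
    qed
  qed simp
  have "real N ^ n \<le> real (card ?K) * (real n * real N * (2 * (real S * real N) + 1))"
  proof -
    have "N ^ n \<le> card ?K * (n * N * (2 * (S * N) + 1))"
      using y mult_right_mono [OF le, of "card V"] unfolding cardU cardV by linarith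
    then have "real (N ^ n) \<le> real (card ?K * (n * N * (2 * (S * N) + 1)))"
      by (simp only: of_nat_le_iff)
    then show ?thesis by (simp add: algebra_simps)
  qed
  also have "\<dots> \<le> real (card ?K) * (real n * real N * ((2 * real S + 1) * real N))"
    using N by (intro mult_left_mono) (auto simp: algebra_simps)
  finally show "1 / (real n * (2 * real S + 1)) * real N ^ CARD('n) \<le> real N ^ 2 * real (card ?K)"
    using n unfolding n_def [symmetric]
    by (simp add: pos_divide_le_eq power2_eq_square mult_ac)
qed

section \<open>Smooth bump functions\<close>

text \<open>The polynomial in \<open>1 / x\<close> makes this family, which contains the classical
  function exp(-1/x) extended by zero, closed under differentiation.\<close>

definition flat_exp :: "real poly \<Rightarrow> real \<Rightarrow> real" where
  "flat_exp p x = (if x > 0 then poly p (1 / x) * exp (- 1 / x) else 0)"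

lemma poly_div_exp_tendsto_0: "((\<lambda>y::real. poly p y / exp y) \<longlongrightarrow> 0) at_top"
proof -
  have "((\<lambda>y. \<Sum>i\<le>degree p. coeff p i * (y ^ i / exp y)) \<longlongrightarrow> (\<Sum>i\<le>degree p. coeff p i * 0)) at_top"
    by (intro tendsto_intros tendsto_power_div_exp_0)
  then show ?thesis by (simp add: poly_altdef sum_divide_distrib)
qed

text \<open>From the right, \<open>y = 1 / x\<close> turns this into a polynomial over
  \<open>exp y\<close> at infinity. As \<open>flat_exp p\<close> vanishes at 0, the quotient is the
  difference quotient at the point where the two branches meet.\<close>

lemma flat_exp_over_x_tendsto_0: "((\<lambda>x. flat_exp p x / x) \<longlongrightarrow> 0) (at 0)"
proof -
  \<comment> \<open>\<open>pCons 0 p\<close> multiplies \<open>p\<close> by its variable and so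
    accounts for the extra factor \<open>1 / x\<close>.\<close>
  have "((\<lambda>x. poly (pCons 0 p) (inverse x) / exp (inverse x)) \<longlongrightarrow> 0) (at_right 0)"
    by (rule filterlim_compose [OF poly_div_exp_tendsto_0 filterlim_inverse_at_top_right])
  then have "((\<lambda>x. flat_exp p x / x) \<longlongrightarrow> 0) (at_right 0)"
    by (rule Lim_transform_eventually)
       (auto simp: eventually_at_right_field flat_exp_def exp_minus divide_simps intro!: exI [of _ 1])
  moreover have "((\<lambda>x. flat_exp p x / x) \<longlongrightarrow> 0) (at_left 0)"
    by (rule tendsto_eventually) (auto simp: eventually_at_left_field flat_exp_def intro!: exI [of _ "-1"])
  ultimately show ?thesis by (simp add: filterlim_split_at)
qed

text \<open>The chain rule produces a factor \<open>1 / x\<^sup>2\<close>, which is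
  \<open>monom 1 2\<close> evaluated at \<open>1 / x\<close>. The origin is settled by the preceding
  limit.\<close>

lemma flat_exp_has_derivative:
  "(flat_exp p has_field_derivative flat_exp (monom 1 2 * (p - pderiv p)) x) (at x)"
proof -
  consider "x > 0" | "x = 0" | "x < 0" by linarith
  then show ?thesis
  proof cases
    case 1
    have "((\<lambda>x. poly p (1 / x) * exp (- 1 / x)) has_field_derivative
        flat_exp (monom 1 2 * (p - pderiv p)) x) (at x)"
      using 1 by (auto intro!: derivative_eq_intros poly_DERIV DERIV_chain2 [where f = "poly p"]
          simp: flat_exp_def poly_monom field_simps power2_eq_square)
    then show ?thesis
      by (rule has_field_derivative_transform_within_open [where S = "{0<..}"])
        (use 1 in \<open>auto simp: flat_exp_def\<close>)
  next
    case 2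
    then show ?thesis
      using flat_exp_over_x_tendsto_0 by (simp add: DERIV_def flat_exp_def)
  next
    case 3
    have "(flat_exp p has_field_derivative 0) (at x)"
      by (rule has_field_derivative_transform_within_open [where S = "{..<0}", OF DERIV_const])
        (use 3 in \<open>auto simp: flat_exp_def\<close>)
    then show ?thesis using 3 by (simp add: flat_exp_def)
  qed
qed

inductive_set flat_bumps :: "(real \<Rightarrow> real) set" where
  prod: "(\<lambda>t. flat_exp p (1 / 4 + t) * flat_exp q (1 / 4 - t)) \<in> flat_bumps"
| add: "\<lbrakk>f \<in> flat_bumps; g \<in> flat_bumps\<rbrakk> \<Longrightarrow> (\<lambda>t. f t + g t) \<in> flat_bumps"

lemma flat_bumps_has_derivative:
  "f \<in> flat_bumps \<Longrightarrow> \<exists>f'\<in>flat_bumps. \<forall>t. (f has_field_derivative f' t) (at t)"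
proof (induction rule: flat_bumps.induct)
  case (prod p q)
  let ?d = "\<lambda>p. monom 1 2 * (p - pderiv p) :: real poly"
  have minus: "flat_exp (- r) t = - flat_exp r t" for r t
    by (simp add: flat_exp_def)
  \<comment> \<open>The inner derivative -1 of \<open>1 / 4 - t\<close> is absorbed into the
    polynomial, so the derivative stays in the class.\<close>
  let ?f' = "\<lambda>t. flat_exp (?d p) (1 / 4 + t) * flat_exp q (1 / 4 - t)
           + flat_exp p (1 / 4 + t) * flat_exp (- ?d q) (1 / 4 - t)"
  have "((\<lambda>t. flat_exp p (1 / 4 + t) * flat_exp q (1 / 4 - t)) has_field_derivative ?f' t) (at t)" for t
  proof -
    have "((\<lambda>t. flat_exp p (1 / 4 + t)) has_field_derivative flat_exp (?d p) (1 / 4 + t) * 1) (at t)"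
      by (rule DERIV_chain2 [OF flat_exp_has_derivative]) (auto intro!: derivative_eq_intros)
    moreover have "((\<lambda>t. flat_exp q (1 / 4 - t)) has_field_derivative flat_exp (?d q) (1 / 4 - t) * (- 1)) (at t)"
      by (rule DERIV_chain2 [OF flat_exp_has_derivative]) (auto intro!: derivative_eq_intros)
    ultimately show ?thesis
      by (auto intro!: derivative_eq_intros simp: minus simp del: mult_minus_right mult_minus_left)
  qed
  then show ?case by (intro bexI [of _ ?f'] allI flat_bumps.intros)
next
  case (add f g)
  then obtain f' g' where "f' \<in> flat_bumps" "g' \<in> flat_bumps"
    "\<And>t. (f has_field_derivative f' t) (at t)" "\<And>t. (g has_field_derivative g' t) (at t)" by blast
  then show ?case
    by (intro bexI [of _ "\<lambda>t. f' t + g' t"]) (auto intro: derivative_intros flat_bumps.intros)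
qed

lemma flat_bumps_eq_0: "f \<in> flat_bumps \<Longrightarrow> \<bar>t\<bar> \<ge> 1 / 4 \<Longrightarrow> f t = 0"
  by (induction rule: flat_bumps.induct) (auto simp: flat_exp_def)

lemma flat_bumps_bounded:
  assumes "f \<in> flat_bumps"
  obtains M where "\<And>t. \<bar>f t\<bar> \<le> M"
proof -
  have "continuous_on {-1 / 4..1 / 4} f"
    using flat_bumps_has_derivative [OF assms]
    by (meson continuous_at_imp_continuous_on DERIV_isCont)
  then have "bounded (f ` {-1 / 4..1 / 4})"
    by (intro compact_imp_bounded compact_continuous_image) auto
  then obtain M where M: "\<And>t. t \<in> {-1 / 4..1 / 4} \<Longrightarrow> \<bar>f t\<bar> \<le> M"
    unfolding bounded_iff real_norm_def by blast
  have "\<bar>f t\<bar> \<le> M" for t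
  proof (cases "\<bar>t\<bar> \<le> 1 / 4")
    case True then show ?thesis by (intro M) auto
  next
    case False
    then have "f t = 0" by (intro flat_bumps_eq_0 assms) auto
    then show ?thesis using M [of 0] by auto
  qed
  then show thesis by (rule that)
qed

text \<open>\<open>B i\<close> is the i-th derivative of one fixed bump \<open>B 0\<close>; carrying
  all orders as a sequence lets partial derivatives of products be written down explicitly.\<close>

locale smooth_bump =
  fixes B :: "nat \<Rightarrow> real \<Rightarrow> real"
  assumes B_derivative: "(B i has_field_derivative B (Suc i) t) (at t)"
    and B_eq_0: "\<bar>t\<bar> \<ge> 1 / 4 \<Longrightarrow> B i t = 0"
    and B_bounded: "\<exists>M. \<forall>t. \<bar>B i t\<bar> \<le> M"
    and B_pos: "B 0 0 > 0"

lemma smooth_bump_exists: "\<exists>B. smooth_bump B"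
proof -
  define b where "b = (\<lambda>t. flat_exp 1 (1 / 4 + t) * flat_exp 1 (1 / 4 - t))"
  define B where "B i = (deriv ^^ i) b" for i
  have deriv: "deriv f \<in> flat_bumps" "(f has_field_derivative deriv f t) (at t)"
    if "f \<in> flat_bumps" for f t
  proof -
    obtain f' where f': "f' \<in> flat_bumps" "\<And>t. (f has_field_derivative f' t) (at t)"
      using flat_bumps_has_derivative [OF \<open>f \<in> flat_bumps\<close>] by blast
    then have "deriv f = f'" by (auto intro: DERIV_imp_deriv)
    with f' show "deriv f \<in> flat_bumps" "(f has_field_derivative deriv f t) (at t)" by auto
  qed
  have mem: "B i \<in> flat_bumps" for i
    by (induction i) (auto simp: B_def b_def intro: flat_bumps.prod deriv)
  have "smooth_bump B"
  proof
    show "(B i has_field_derivative B (Suc i) t) (at t)" for i t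
      using deriv(2) [OF mem [of i]] by (simp add: B_def)
    show "B 0 0 > 0" by (simp add: B_def b_def flat_exp_def)
    show "\<exists>M. \<forall>t. \<bar>B i t\<bar> \<le> M" for i
      using flat_bumps_bounded [OF mem] by metis
  qed (rule flat_bumps_eq_0 [OF mem])
  then show ?thesis by blast
qed

section \<open>Symbols with bumps at lattice points\<close>

lemma infdist_hyperplane_le:
  fixes \<alpha> \<xi> :: "real ^ 'n"
  assumes "\<alpha> $ i \<noteq> 0"
  shows "infdist \<xi> {\<xi>. (\<Sum>j\<in>UNIV. \<xi> $ j * \<alpha> $ j) = 0} \<le> \<bar>\<Sum>j\<in>UNIV. \<xi> $ j * \<alpha> $ j\<bar> / \<bar>\<alpha> $ i\<bar>"
proof -
  define t where "t = (\<Sum>j\<in>UNIV. \<xi> $ j * \<alpha> $ j) / \<alpha> $ i"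
  have "(\<Sum>j\<in>UNIV. (\<xi> - t *\<^sub>R axis i 1) $ j * \<alpha> $ j) = (\<Sum>j\<in>UNIV. \<xi> $ j * \<alpha> $ j) - t * \<alpha> $ i"
    by (simp add: left_diff_distrib sum_subtractf axis_def if_distrib [of "\<lambda>x. x * _"]
        if_distrib [of "\<lambda>x. _ * x"] cong: if_cong)
  also have "\<dots> = 0" using assms by (simp add: t_def)
  finally have "infdist \<xi> {\<xi>. (\<Sum>j\<in>UNIV. \<xi> $ j * \<alpha> $ j) = 0} \<le> dist \<xi> (\<xi> - t *\<^sub>R axis i 1)"
    by (intro infdist_le) simp
  then show ?thesis by (simp add: dist_norm t_def)
qed

context smooth_bump
begin

text \<open>Rounding selects the only bump that can be non-zero at \<open>\<xi>\<close>, so a sum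
  over the lattice becomes a single product. The order \<open>\<gamma>\<close> is a parameter so
  that derivatives stay in the family.\<close>

definition lattice_bump :: "(('n::finite \<Rightarrow> int) \<Rightarrow> real) \<Rightarrow> ('n \<Rightarrow> nat) \<Rightarrow> real ^ 'n \<Rightarrow> real" where
  "lattice_bump A \<gamma> \<xi> =
     A (\<lambda>j. round (\<xi> $ j)) * (\<Prod>j\<in>UNIV. B (\<gamma> j) (\<xi> $ j - of_int (round (\<xi> $ j))))"

text \<open>The coefficients jump only where some \<open>\<xi> $ j\<close> is a half-integer, and there the bump vanishes
  in a neighbourhood.\<close>

lemma lattice_bump_has_derivative:
  "(lattice_bump A \<gamma> has_derivative
      (\<lambda>h. \<Sum>j\<in>UNIV. h $ j * lattice_bump A (\<gamma>(j := Suc (\<gamma> j))) \<xi>)) (at \<xi>)"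
proof (cases "\<forall>j. \<bar>\<xi> $ j - of_int (round (\<xi> $ j))\<bar> < 1 / 2")
  case True
  define k where "k j = round (\<xi> $ j)" for j
  \<comment> \<open>On this open cube rounding is constant, so the symbol is a fixed multiple of a
    product of smooth functions.\<close>
  define S where "S = {\<eta> :: real ^ 'a. \<forall>j. \<bar>\<eta> $ j - of_int (k j)\<bar> < 1 / 2}"
  have "S = (\<Inter>j\<in>UNIV. {\<eta>. \<bar>\<eta> $ j - of_int (k j)\<bar> < 1 / 2})"
    by (auto simp: S_def)
  moreover have "open {\<eta> :: real ^ 'a. \<bar>\<eta> $ j - of_int (k j)\<bar> < 1 / 2}" for j
    by (intro open_Collect_less continuous_intros)
  ultimately have "open S" by (simp add: open_INT)
  have round: "round (\<eta> $ j) = k j" if "\<eta> \<in> S" for \<eta> j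
    using that by (intro round_unique') (auto simp: S_def)
  have B': "((\<lambda>\<eta>. B i (\<eta> $ j - of_int (k j))) has_derivative
      (\<lambda>h. h $ j * B (Suc i) (\<xi> $ j - of_int (k j)))) (at \<xi>)" for i j
  proof -
    have "(B i has_derivative (\<lambda>x. x * B (Suc i) (\<xi> $ j - of_int (k j)))) (at (\<xi> $ j - of_int (k j)))"
      using B_derivative [of i "\<xi> $ j - of_int (k j)"]
      by (simp add: has_field_derivative_def mult_commute_abs)
    moreover have "((\<lambda>\<eta>. \<eta> $ j - of_int (k j)) has_derivative (\<lambda>h. h $ j)) (at \<xi>)"
      using bounded_linear_imp_has_derivative [OF bounded_linear_vec_nth [of j]]
      by (auto intro!: derivative_eq_intros)
    ultimately show ?thesis by (rule has_derivative_compose [rotated])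
  qed
  have "((\<lambda>\<eta>. A k * (\<Prod>j\<in>UNIV. B (\<gamma> j) (\<eta> $ j - of_int (k j)))) has_derivative
      (\<lambda>h. A k * (\<Sum>i\<in>UNIV. h $ i * B (Suc (\<gamma> i)) (\<xi> $ i - of_int (k i)) *
         (\<Prod>j\<in>UNIV - {i}. B (\<gamma> j) (\<xi> $ j - of_int (k j)))))) (at \<xi>)"
    by (intro has_derivative_mult_right has_derivative_prod B')
  moreover have "A k * (\<Sum>i\<in>UNIV. h $ i * B (Suc (\<gamma> i)) (\<xi> $ i - of_int (k i)) *
         (\<Prod>j\<in>UNIV - {i}. B (\<gamma> j) (\<xi> $ j - of_int (k j))))
      = (\<Sum>i\<in>UNIV. h $ i * lattice_bump A (\<gamma>(i := Suc (\<gamma> i))) \<xi>)" for h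
    unfolding sum_distrib_left
  proof (rule sum.cong [OF refl])
    fix i
    have "(\<Prod>j\<in>UNIV. B ((\<gamma>(i := Suc (\<gamma> i))) j) (\<xi> $ j - of_int (k j)))
        = B (Suc (\<gamma> i)) (\<xi> $ i - of_int (k i)) * (\<Prod>j\<in>UNIV - {i}. B (\<gamma> j) (\<xi> $ j - of_int (k j)))"
      by (simp add: prod.remove [of UNIV i])
    then show "A k * (h $ i * B (Suc (\<gamma> i)) (\<xi> $ i - of_int (k i)) *
         (\<Prod>j\<in>UNIV - {i}. B (\<gamma> j) (\<xi> $ j - of_int (k j))))
      = h $ i * lattice_bump A (\<gamma>(i := Suc (\<gamma> i))) \<xi>"
      by (simp only: lattice_bump_def k_def [symmetric] mult_ac)
  qed
  ultimately have "((\<lambda>\<eta>. A k * (\<Prod>j\<in>UNIV. B (\<gamma> j) (\<eta> $ j - of_int (k j)))) has_derivative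
      (\<lambda>h. \<Sum>j\<in>UNIV. h $ j * lattice_bump A (\<gamma>(j := Suc (\<gamma> j))) \<xi>)) (at \<xi>)"
    by simp
  then show ?thesis
    by (rule has_derivative_transform_within_open [where s = S])
      (use True \<open>open S\<close> in \<open>auto simp: S_def [symmetric] round lattice_bump_def k_def [symmetric]\<close>,
       auto simp: S_def k_def)
next
  case False
  then obtain i where i: "\<bar>\<xi> $ i - of_int (round (\<xi> $ i))\<bar> \<ge> 1 / 2"
    by (auto simp: not_less)
  \<comment> \<open>A point of this strip closer than 1/4 to its rounded value would put
    \<open>\<xi> $ i\<close> within 3/8 of an integer, although its distance to the nearest one is
    1/2.\<close>
  define S where "S = {\<eta> :: real ^ 'a. \<bar>\<eta> $ i - \<xi> $ i\<bar> < 1 / 8}"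
  have "open S" unfolding S_def by (intro open_Collect_less continuous_intros)
  have 0: "lattice_bump A \<gamma> \<eta> = 0" if "\<eta> \<in> S" for \<eta> \<gamma>
  proof -
    have "\<bar>\<eta> $ i - of_int (round (\<eta> $ i))\<bar> \<ge> 1 / 4"
    proof (rule ccontr)
      assume *: "\<not> ?thesis"
      then have near: "\<bar>\<xi> $ i - of_int (round (\<eta> $ i))\<bar> < 1 / 2"
        using that unfolding S_def mem_Collect_eq by linarith
      then have "round (\<xi> $ i) = round (\<eta> $ i)" by (rule round_unique')
      then show False using i near by simp
    qed
    then have "B (\<gamma> i) (\<eta> $ i - of_int (round (\<eta> $ i))) = 0" by (rule B_eq_0)
    then show ?thesis by (auto simp: lattice_bump_def)
  qed
  have "\<xi> \<in> S" by (simp add: S_def)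
  have "(lattice_bump A \<gamma> has_derivative (\<lambda>h. 0)) (at \<xi>)"
    by (rule has_derivative_transform_within_open [where s = S, OF has_derivative_const])
      (use \<open>open S\<close> \<open>\<xi> \<in> S\<close> 0 in auto)
  then show ?thesis using 0 [OF \<open>\<xi> \<in> S\<close>] by simp
qed

lemma partial_deriv_lattice_bump:
  "partial_deriv i (lattice_bump A \<gamma>) = lattice_bump A (\<gamma>(i := Suc (\<gamma> i)))"
proof
  fix \<xi>
  have "((\<lambda>t. lattice_bump A \<gamma> (\<xi> + t *\<^sub>R axis i 1)) has_derivative
      (\<lambda>t. \<Sum>j\<in>UNIV. (t *\<^sub>R axis i 1) $ j * lattice_bump A (\<gamma>(j := Suc (\<gamma> j))) \<xi>)) (at 0)"
  proof -
    have "((\<lambda>t. \<xi> + t *\<^sub>R axis i 1) has_derivative (\<lambda>t. t *\<^sub>R axis i 1)) (at 0)"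
      by (auto intro!: derivative_eq_intros)
    moreover have "(lattice_bump A \<gamma> has_derivative
        (\<lambda>h. \<Sum>j\<in>UNIV. h $ j * lattice_bump A (\<gamma>(j := Suc (\<gamma> j))) \<xi>)) (at (\<xi> + 0 *\<^sub>R axis i 1))"
      by (simp add: lattice_bump_has_derivative)
    ultimately show ?thesis by (rule has_derivative_compose)
  qed
  moreover have "(\<Sum>j\<in>UNIV. (t *\<^sub>R axis i 1) $ j * lattice_bump A (\<gamma>(j := Suc (\<gamma> j))) \<xi>)
      = lattice_bump A (\<gamma>(i := Suc (\<gamma> i))) \<xi> * t" for t
    by (subst sum.remove [of _ i]) (auto simp: axis_def)
  ultimately have "((\<lambda>t. lattice_bump A \<gamma> (\<xi> + t *\<^sub>R axis i 1)) has_field_derivative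
      lattice_bump A (\<gamma>(i := Suc (\<gamma> i))) \<xi>) (at 0)"
    by (simp add: has_field_derivative_def)
  then show "partial_deriv i (lattice_bump A \<gamma>) \<xi> = lattice_bump A (\<gamma>(i := Suc (\<gamma> i))) \<xi>"
    unfolding partial_deriv_def by (rule DERIV_imp_deriv)
qed

text \<open>Only the counts in \<open>js\<close> matter: whichever list \<open>multi_deriv\<close>
  picks, the result is again a \<open>lattice_bump\<close>.\<close>

lemma iterated_partial_lattice_bump:
  "iterated_partial js (lattice_bump A \<gamma>) = lattice_bump A (\<lambda>j. \<gamma> j + count_list js j)"
proof (induction js)
  case (Cons i js)
  have "(\<lambda>j. \<gamma> j + count_list js j)(i := Suc (\<gamma> i + count_list js i)) = (\<lambda>j. \<gamma> j + count_list (i # js) j)"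
    by auto
  then show ?case
    using Cons by (simp add: iterated_partial_def partial_deriv_lattice_bump)
qed (simp add: iterated_partial_def)

section \<open>Size, continuity and support of the symbols\<close>

text \<open>A product of bounds for the one-dimensional factors works, uniformly in the
  coefficients; taking \<open>max 1\<close> makes it positive.\<close>

lemma lattice_bump_bounded:
  "\<exists>M>0. \<forall>A \<xi>. (\<forall>k. \<bar>A k\<bar> \<le> 1) \<longrightarrow> \<bar>lattice_bump A \<gamma> \<xi>\<bar> \<le> M"
proof -
  obtain b where b: "\<And>i t. \<bar>B i t\<bar> \<le> b i" using B_bounded by metis
  then have pos: "max 1 (b i) > 0" for i by simp
  show ?thesis
  proof (intro exI conjI allI impI)
    show "(\<Prod>j\<in>UNIV. max 1 (b (\<gamma> j))) > 0" by (simp add: prod_pos)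
    fix A :: "('a \<Rightarrow> int) \<Rightarrow> real" and \<xi> :: "real ^ 'a" assume A: "\<forall>k. \<bar>A k\<bar> \<le> 1"
    have "\<bar>lattice_bump A \<gamma> \<xi>\<bar> \<le> 1 * (\<Prod>j\<in>UNIV. max 1 (b (\<gamma> j)))"
      unfolding lattice_bump_def abs_mult abs_prod
      by (intro mult_mono prod_mono A [rule_format] prod_nonneg)
        (auto intro: order_trans [OF b])
    then show "\<bar>lattice_bump A \<gamma> \<xi>\<bar> \<le> (\<Prod>j\<in>UNIV. max 1 (b (\<gamma> j)))" by simp
  qed
qed

text \<open>By the mean value inequality, since the gradient consists of bounded functions of the
  same family. The Lipschitz bound later controls the error of freezing the symbol at a lattice
  point.\<close>

lemma lattice_bump_lipschitz:
  fixes A :: "('n::finite \<Rightarrow> int) \<Rightarrow> real"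
  assumes A: "\<And>k. \<bar>A k\<bar> \<le> 1"
  shows "\<exists>K>0. \<forall>\<xi> \<eta>. \<bar>lattice_bump A \<gamma> \<xi> - lattice_bump A \<gamma> \<eta>\<bar> \<le> K * norm (\<xi> - \<eta>)"
proof -
  have "\<exists>M>0. \<forall>\<xi>. \<bar>lattice_bump A \<delta> \<xi>\<bar> \<le> M" for \<delta>
    using lattice_bump_bounded [of \<delta>] A by blast
  then obtain M where M: "\<And>\<delta>. M \<delta> > 0" "\<And>\<delta> \<xi>. \<bar>lattice_bump A \<delta> \<xi>\<bar> \<le> M \<delta>" by metis
  define K where "K = (\<Sum>j\<in>UNIV. M (\<gamma>(j := Suc (\<gamma> j))))"
  show ?thesis
  proof (intro exI conjI allI)
    show "K > 0" unfolding K_def by (intro sum_pos M) auto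
    fix \<xi> \<eta> :: "real ^ 'n"
    have "onorm (\<lambda>h :: real ^ 'n. \<Sum>j\<in>UNIV. h $ j * lattice_bump A (\<gamma>(j := Suc (\<gamma> j))) x) \<le> K" for x
    proof (rule onorm_le)
      fix h :: "real ^ 'n"
      have "\<bar>\<Sum>j\<in>UNIV. h $ j * lattice_bump A (\<gamma>(j := Suc (\<gamma> j))) x\<bar>
          \<le> (\<Sum>j\<in>UNIV. norm h * M (\<gamma>(j := Suc (\<gamma> j))))"
        by (rule order_trans [OF sum_abs sum_mono])
          (auto simp: abs_mult intro!: mult_mono M component_le_norm_cart)
      then show "norm (\<Sum>j\<in>UNIV. h $ j * lattice_bump A (\<gamma>(j := Suc (\<gamma> j))) x) \<le> K * norm h"
        by (simp add: K_def sum_distrib_left [symmetric] mult.commute)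
    qed
    then have "norm (lattice_bump A \<gamma> \<xi> - lattice_bump A \<gamma> \<eta>) \<le> K * norm (\<xi> - \<eta>)"
      by (intro differentiable_bound [of UNIV]) (auto intro: lattice_bump_has_derivative)
    then show "\<bar>lattice_bump A \<gamma> \<xi> - lattice_bump A \<gamma> \<eta>\<bar> \<le> K * norm (\<xi> - \<eta>)" by simp
  qed
qed

lemma lattice_bump_at_lattice:
  "lattice_bump A (\<lambda>_. 0) (\<chi> j. of_int (l j)) = A l * B 0 0 ^ CARD('n)" for l :: "'n::finite \<Rightarrow> int"
  by (simp add: lattice_bump_def)

text \<open>Passing from \<open>\<xi>\<close> to its rounded point changes the linear form by a
  bounded amount, and there a non-zero coefficient keeps the form at most 1. One \<open>C\<close>
  serves all orders \<open>\<gamma>\<close>.\<close>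

lemma lattice_bump_support:
  fixes \<alpha> :: "real ^ 'n"
  assumes i: "\<alpha> $ i \<noteq> 0"
    and A: "\<And>k. A k \<noteq> 0 \<Longrightarrow> \<bar>\<Sum>j\<in>UNIV. \<alpha> $ j * of_int (k j)\<bar> \<le> 1"
  shows "\<exists>C>0. \<forall>\<gamma> \<xi>. lattice_bump A \<gamma> \<xi> \<noteq> 0 \<longrightarrow>
    infdist \<xi> {\<xi>. (\<Sum>j\<in>UNIV. \<xi> $ j * \<alpha> $ j) = 0} \<le> C"
proof (intro exI conjI allI impI)
  show "(1 + (\<Sum>j\<in>UNIV. \<bar>\<alpha> $ j\<bar>)) / \<bar>\<alpha> $ i\<bar> > 0"
    using i by (intro divide_pos_pos add_pos_nonneg sum_nonneg) auto
  fix \<gamma> \<xi> assume "lattice_bump A \<gamma> \<xi> \<noteq> 0"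
  then have "A (\<lambda>j. round (\<xi> $ j)) \<noteq> 0" by (auto simp: lattice_bump_def)
  then have 1: "\<bar>\<Sum>j\<in>UNIV. \<alpha> $ j * of_int (round (\<xi> $ j))\<bar> \<le> 1" by (rule A)
  have 2: "\<bar>\<Sum>j\<in>UNIV. \<alpha> $ j * (\<xi> $ j - of_int (round (\<xi> $ j)))\<bar> \<le> (\<Sum>j\<in>UNIV. \<bar>\<alpha> $ j\<bar>)"
  proof (rule order_trans [OF sum_abs sum_mono])
    fix j
    have "\<bar>\<xi> $ j - of_int (round (\<xi> $ j))\<bar> \<le> 1"
      using of_int_round_abs_le [of "\<xi> $ j"] by linarith
    then show "\<bar>\<alpha> $ j * (\<xi> $ j - of_int (round (\<xi> $ j)))\<bar> \<le> \<bar>\<alpha> $ j\<bar>"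
      by (simp add: abs_mult mult_left_le)
  qed
  have "(\<Sum>j\<in>UNIV. \<xi> $ j * \<alpha> $ j) = (\<Sum>j\<in>UNIV. \<alpha> $ j * of_int (round (\<xi> $ j)))
      + (\<Sum>j\<in>UNIV. \<alpha> $ j * (\<xi> $ j - of_int (round (\<xi> $ j))))"
    by (simp add: sum.distrib [symmetric] algebra_simps)
  then have "\<bar>\<Sum>j\<in>UNIV. \<xi> $ j * \<alpha> $ j\<bar> \<le> 1 + (\<Sum>j\<in>UNIV. \<bar>\<alpha> $ j\<bar>)"
    using 1 2 by linarith
  then show "infdist \<xi> {\<xi>. (\<Sum>j\<in>UNIV. \<xi> $ j * \<alpha> $ j) = 0} \<le> (1 + (\<Sum>j\<in>UNIV. \<bar>\<alpha> $ j\<bar>)) / \<bar>\<alpha> $ i\<bar>"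
    by (intro order_trans [OF infdist_hyperplane_le [OF i]] divide_right_mono) auto
qed

text \<open>Where a derivative vanishes there is nothing to prove; elsewhere the distance is at most
  \<open>C\<close>, so \<open>(C / infdist \<xi> \<Gamma>) ^ N\<close> is at least 1 and the uniform
  bound \<open>M\<close> implies the required estimate.\<close>

lemma lattice_bump_adapted:
  fixes \<alpha> :: "real ^ 'n"
  defines "\<Gamma> \<equiv> {\<xi> :: real ^ 'n. (\<Sum>j\<in>UNIV. \<xi> $ j * \<alpha> $ j) = 0}"
  assumes i: "\<alpha> $ i \<noteq> 0" and A: "\<And>k. \<bar>A k\<bar> \<le> 1"
    and supp: "\<And>k. A k \<noteq> 0 \<Longrightarrow> \<bar>\<Sum>j\<in>UNIV. \<alpha> $ j * of_int (k j)\<bar> \<le> 1"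
  shows "lattice_bump A \<gamma> \<in> adapted_multipliers \<Gamma>"
proof -
  have "iterated_partial js (lattice_bump A \<gamma>) differentiable (at \<xi>)" for js \<xi>
    unfolding iterated_partial_lattice_bump differentiable_def
    using lattice_bump_has_derivative by blast
  moreover have "\<exists>C. \<forall>\<xi>. \<xi> \<notin> \<Gamma> \<longrightarrow> \<bar>multi_deriv \<beta> (lattice_bump A \<gamma>) \<xi>\<bar> \<le> C / infdist \<xi> \<Gamma> ^ N" for \<beta> N
  proof -
    obtain \<delta> where \<delta>: "multi_deriv \<beta> (lattice_bump A \<gamma>) = lattice_bump A \<delta>"
      unfolding multi_deriv_def iterated_partial_lattice_bump by blast
    obtain M where M: "M > 0" "\<And>\<xi>. \<bar>lattice_bump A \<delta> \<xi>\<bar> \<le> M"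
      using lattice_bump_bounded [of \<delta>] A by blast
    obtain C where C: "C > 0" "\<And>\<delta> \<xi>. lattice_bump A \<delta> \<xi> \<noteq> 0 \<Longrightarrow> infdist \<xi> \<Gamma> \<le> C"
      using lattice_bump_support [OF i supp] unfolding \<Gamma>_def by blast
    have "closed \<Gamma>"
      unfolding \<Gamma>_def by (intro closed_Collect_eq continuous_intros)
    moreover have "0 \<in> \<Gamma>" by (simp add: \<Gamma>_def)
    ultimately have pos: "infdist \<xi> \<Gamma> > 0" if "\<xi> \<notin> \<Gamma>" for \<xi>
      using that infdist_pos_not_in_closed by blast
    have "\<bar>lattice_bump A \<delta> \<xi>\<bar> \<le> M * C ^ N / infdist \<xi> \<Gamma> ^ N" if "\<xi> \<notin> \<Gamma>" for \<xi>
    proof (cases "lattice_bump A \<delta> \<xi> = 0")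
      case True
      then show ?thesis using M(1) C(1) pos [OF that] by simp
    next
      case False
      have "infdist \<xi> \<Gamma> ^ N \<le> C ^ N"
        using C(2) [OF False] pos [OF that] by (intro power_mono) auto
      then have "\<bar>lattice_bump A \<delta> \<xi>\<bar> * infdist \<xi> \<Gamma> ^ N \<le> M * C ^ N"
        using M pos [OF that] by (intro mult_mono) auto
      then show ?thesis using pos [OF that] by (simp add: pos_le_divide_eq)
    qed
    then show ?thesis unfolding \<delta> by blast
  qed
  ultimately show ?thesis by (simp add: adapted_multipliers_def smooth_function_on_def)
qed

end

section \<open>Gaussian integrals and wave packets\<close>

text \<open>An affine substitution reduces this to the characteristic function of the standard
  normal distribution.\<close>

lemma gaussian_fourier:
  assumes "\<delta> > 0"
  shows "has_bochner_integral lborel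
    (\<lambda>x. of_real (exp (- (pi * ((x - c) / \<delta>)\<^sup>2))) * iexp (2 * pi * y * x))
    (of_real (\<delta> * exp (- (pi * (\<delta> * y)\<^sup>2))) * iexp (2 * pi * y * c))"
proof -
  define s where "s = sqrt (2 * pi)"
  have s: "s > 0" "s\<^sup>2 = 2 * pi" by (auto simp: s_def)
  \<comment> \<open>With \<open>u = s * ((x - c) / \<delta>)\<close>, the relation
    \<open>s\<^sup>2 = 2 * pi\<close> turns \<open>t * u\<close> into the phase
    \<open>2 * pi * y * (x - c)\<close> and \<open>u\<^sup>2 / 2\<close> into the Gaussian
    exponent.\<close>
  define t where "t = s * \<delta> * y"
  let ?f = "\<lambda>x. of_real (std_normal_density x) * iexp (t * x)"
  have int: "integrable lborel ?f"
  proof (rule Bochner_Integration.integrable_bound)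
    show "integrable lborel std_normal_density" by simp
  qed (auto simp: norm_mult)
  have "integral\<^sup>L lborel ?f = char std_normal_distribution t"
    unfolding char_def
    by (subst integral_density) (auto simp: scaleR_conv_of_real)
  also have "\<dots> = of_real (exp (- t\<^sup>2 / 2))"
    by (simp add: char_std_normal_distribution)
  finally have "has_bochner_integral lborel ?f (of_real (exp (- t\<^sup>2 / 2)))"
    using int by (simp add: has_bochner_integral_iff)
  then have "has_bochner_integral lborel (\<lambda>x. ?f (- (s * c / \<delta>) + s / \<delta> * x))
      (of_real (exp (- t\<^sup>2 / 2)) /\<^sub>R \<bar>s / \<delta>\<bar>)"
    by (rule lborel_has_bochner_integral_real_affine_iff [THEN iffD1, rotated])
      (use s assms in auto)
  \<comment> \<open>The factor \<open>s\<close> removes the normalisation of the normal density, and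
    the phase restores the centre \<open>c\<close>.\<close>
  then have "has_bochner_integral lborel
      (\<lambda>x. of_real s * iexp (2 * pi * y * c) * ?f (- (s * c / \<delta>) + s / \<delta> * x))
      (of_real s * iexp (2 * pi * y * c) * (of_real (exp (- t\<^sup>2 / 2)) /\<^sub>R \<bar>s / \<delta>\<bar>))"
    by (rule has_bochner_integral_mult_right)
  moreover have "of_real s * iexp (2 * pi * y * c) * ?f (- (s * c / \<delta>) + s / \<delta> * x)
      = of_real (exp (- (pi * ((x - c) / \<delta>)\<^sup>2))) * iexp (2 * pi * y * x)" for x
  proof -
    have arg: "- (s * c / \<delta>) + s / \<delta> * x = s * ((x - c) / \<delta>)"
      by (simp add: right_diff_distrib diff_divide_distrib)
    have ph: "t * (s * ((x - c) / \<delta>)) = 2 * pi * y * x - 2 * pi * y * c"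
    proof -
      have "t * (s * ((x - c) / \<delta>)) = s\<^sup>2 * y * (x - c)"
        using assms by (simp add: t_def power2_eq_square)
      then show ?thesis by (simp add: s algebra_simps)
    qed
    have g: "s * std_normal_density (s * ((x - c) / \<delta>)) = exp (- (pi * ((x - c) / \<delta>)\<^sup>2))"
      using s by (simp add: std_normal_density_def power_mult_distrib s_def [symmetric]
          del: times_divide_eq_right) simp
    have e: "iexp (2 * pi * y * c) * iexp (2 * pi * y * x - 2 * pi * y * c) = iexp (2 * pi * y * x)"
      by (simp add: exp_add [symmetric] algebra_simps)
    have assoc: "of_real a * u * (of_real b * v) = of_real (a * b) * (u * v)" for a b :: real and u v :: complex
      by simp
    show ?thesis unfolding arg ph assoc g e ..
  qed
  moreover have "of_real s * iexp (2 * pi * y * c) * (of_real (exp (- t\<^sup>2 / 2)) /\<^sub>R \<bar>s / \<delta>\<bar>)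
      = of_real (\<delta> * exp (- (pi * (\<delta> * y)\<^sup>2))) * iexp (2 * pi * y * c)"
    using s assms by (simp add: scaleR_conv_of_real t_def power_mult_distrib)
  ultimately show ?thesis by simp
qed

lemma gaussian_integral:
  assumes "\<delta> > 0"
  shows "has_bochner_integral lborel (\<lambda>x. exp (- (pi * ((x - c) / \<delta>)\<^sup>2))) \<delta>"
proof -
  have "has_bochner_integral lborel (\<lambda>x. complex_of_real (exp (- (pi * ((x - c) / \<delta>)\<^sup>2)))) (of_real \<delta>)"
    using gaussian_fourier [OF assms, of c 0] by simp
  then show ?thesis
    using integrable_Re [of lborel "\<lambda>x. complex_of_real (exp (- (pi * ((x - c) / \<delta>)\<^sup>2)))"]
    by (simp add: has_bochner_integral_iff)
qed

text \<open>Lebesgue measure on vectors is the image of a product measure indexed by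
  \<open>Basis\<close>; the coordinate axes enumerate \<open>Basis\<close>, so the integral
  factorises over the coordinates.\<close>

lemma has_bochner_integral_prod_vec:
  fixes g :: "'n::finite \<Rightarrow> real \<Rightarrow> 'a::{real_normed_field,banach,second_countable_topology}"
  assumes "\<And>j. has_bochner_integral lborel (g j) (I j)"
  shows "has_bochner_integral lborel (\<lambda>\<xi> :: real ^ 'n. \<Prod>j\<in>UNIV. g j (\<xi> $ j)) (\<Prod>j\<in>UNIV. I j)"
proof -
  let ?ax = "\<lambda>j::'n. axis j (1::real)"
  have inj: "inj ?ax" by (auto simp: inj_on_def axis_eq_axis)
  have Basis: "(Basis :: (real ^ 'n) set) = range ?ax"
    by (auto simp: Basis_vec_def)
  define h where "h b = g (inv ?ax b)" for b
  define J where "J b = I (inv ?ax b)" for b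
  have hJ: "has_bochner_integral lborel (h b) (J b)" for b
    unfolding h_def J_def by (rule assms)
  interpret product_sigma_finite "\<lambda>b :: real ^ 'n. lborel :: real measure"
    by standard
  have reindex: "(\<Prod>b\<in>Basis. k (inv ?ax b) b) = (\<Prod>j\<in>UNIV. k j (?ax j))" for k :: "'n \<Rightarrow> real ^ 'n \<Rightarrow> 'a"
    unfolding Basis by (simp add: prod.reindex [OF inj] inv_f_f [OF inj])
  have 1: "has_bochner_integral (\<Pi>\<^sub>M b\<in>Basis. lborel) (\<lambda>x. \<Prod>b\<in>Basis. h b (x b)) (\<Prod>b\<in>Basis. J b)"
    using product_integrable_prod [of Basis h] product_integral_prod [of Basis h] hJ
    by (simp add: has_bochner_integral_iff)
  have [measurable]: "g j \<in> borel_measurable borel" for j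
    using assms [of j] by (auto simp: has_bochner_integral_iff dest: borel_measurable_integrable)
  have meas: "(\<lambda>\<xi> :: real ^ 'n. \<Prod>j\<in>UNIV. g j (\<xi> $ j)) \<in> borel_measurable borel"
    by measurable
  have T: "(\<lambda>f. \<Sum>b\<in>Basis. f b *\<^sub>R b) \<in> (\<Pi>\<^sub>M b\<in>Basis. lborel) \<rightarrow>\<^sub>M (borel :: (real ^ 'n) measure)"
    by measurable
  have comp: "(\<Prod>j\<in>UNIV. g j ((\<Sum>b\<in>Basis. x b *\<^sub>R b) $ j)) = (\<Prod>b\<in>Basis. h b (x b))" for x
  proof -
    have "(\<Sum>b\<in>Basis. x b *\<^sub>R b) $ j = x (?ax j)" for j
    proof -
      have "(\<Sum>b\<in>Basis. x b *\<^sub>R b) $ j = (\<Sum>b\<in>Basis. x b *\<^sub>R b) \<bullet> ?ax j"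
        by (simp add: inner_axis)
      also have "\<dots> = x (?ax j)" by (rule inner_sum_left_Basis) (auto simp: Basis)
      finally show ?thesis .
    qed
    then show ?thesis
      unfolding h_def using reindex [of "\<lambda>j b. g j (x b)"] by simp
  qed
  have "(\<Prod>b\<in>Basis. J b) = (\<Prod>j\<in>UNIV. I j)"
    unfolding J_def using reindex [of "\<lambda>j b. I j"] by simp
  with 1 show ?thesis
    unfolding lborel_eq [where 'a = "real ^ 'n"]
    by (simp only: has_bochner_integral_iff integrable_distr_eq [OF T meas] integral_distr [OF T meas]
        comp simp_thms)
qed

text \<open>Integrals are computed with \<open>lborel\<close>, while the operators are defined with
  its completion \<open>lebesgue\<close>.\<close>

lemma has_bochner_integral_completion:
  fixes f :: "'a \<Rightarrow> 'b::{banach,second_countable_topology}"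
  assumes "has_bochner_integral M f I"
  shows "has_bochner_integral (completion M) f I"
proof -
  have f: "f \<in> M \<rightarrow>\<^sub>M borel"
    using assms by (auto simp: has_bochner_integral_iff intro: borel_measurable_integrable)
  show ?thesis
    using assms unfolding has_bochner_integral_iff integrable_completion [OF f] integral_completion [OF f] .
qed

text \<open>A Gaussian of width \<open>1 / \<delta>\<close> modulated to frequency \<open>k\<close>.
  It has height 1, so that its Fourier transform is a Gaussian of mass 1 and width
  \<open>\<delta>\<close> about \<open>k\<close>.\<close>

definition wave_packet :: "real \<Rightarrow> real \<Rightarrow> real \<Rightarrow> complex" where
  "wave_packet \<delta> k x = of_real (exp (- (pi * (\<delta> * x)\<^sup>2))) * iexp (2 * pi * k * x)"

lemma cmod_wave_packet: "cmod (wave_packet \<delta> k x) = exp (- (pi * (\<delta> * x)\<^sup>2))"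
  by (simp add: wave_packet_def norm_mult)

lemma wave_packet_transform:
  assumes "\<delta> > 0"
  shows "has_bochner_integral lebesgue
    (\<lambda>x. wave_packet \<delta> k x * exp (- 2 * of_real pi * \<i> * of_real x * of_real \<xi>))
    (of_real (exp (- (pi * ((\<xi> - k) / \<delta>)\<^sup>2)) / \<delta>))"
proof -
  let ?f = "\<lambda>x. of_real (exp (- (pi * ((x - 0) / (1 / \<delta>))\<^sup>2))) * iexp (2 * pi * (k - \<xi>) * x)"
  have eq: "?f x = wave_packet \<delta> k x * exp (- 2 * of_real pi * \<i> * of_real x * of_real \<xi>)" for x
  proof -
    have "iexp (2 * pi * (k - \<xi>) * x)
        = iexp (2 * pi * k * x) * exp (- 2 * of_real pi * \<i> * of_real x * of_real \<xi>)"
      by (simp add: exp_add [symmetric] algebra_simps)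
    then show ?thesis by (simp add: wave_packet_def mult.commute [of \<delta>])
  qed
  have "(1 / \<delta> * (k - \<xi>))\<^sup>2 = ((\<xi> - k) / \<delta>)\<^sup>2"
    by (simp add: power2_commute power_divide)
  then have "has_bochner_integral lborel ?f (of_real (exp (- (pi * ((\<xi> - k) / \<delta>)\<^sup>2)) / \<delta>))"
    using gaussian_fourier [of "1 / \<delta>" 0 "k - \<xi>"] assms by simp
  then show ?thesis
    unfolding eq by (rule has_bochner_integral_completion)
qed

text \<open>The one-dimensional formula is multiplied over the coordinates. The phases combine into
  the sum of the frequencies \<open>l j\<close>, which is zero at the lattice points carrying the
  symbol.\<close>

lemma gaussian_kernel_integral:
  fixes l :: "'n::finite \<Rightarrow> real"
  assumes "\<delta> > 0"
  shows "has_bochner_integral lborel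
    (\<lambda>\<xi> :: real ^ 'n. \<Prod>j\<in>UNIV. of_real (exp (- (pi * ((\<xi> $ j - l j) / \<delta>)\<^sup>2)) / \<delta>)
        * exp (2 * of_real pi * \<i> * of_real x * of_real (\<xi> $ j)))
    (of_real (exp (- (pi * (\<delta> * x)\<^sup>2)) ^ CARD('n)) * iexp (2 * pi * x * (\<Sum>j\<in>UNIV. l j)))"
proof -
  have "has_bochner_integral lborel (\<lambda>t. of_real (exp (- (pi * ((t - l j) / \<delta>)\<^sup>2)) / \<delta>)
        * exp (2 * of_real pi * \<i> * of_real x * of_real t))
      (of_real (exp (- (pi * (\<delta> * x)\<^sup>2))) * iexp (2 * pi * x * l j))" for j
    using has_bochner_integral_divide_zero [OF gaussian_fourier [OF assms, of "l j" x], of "of_real \<delta>"] assms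
    by (simp add: mult_ac)
  from has_bochner_integral_prod_vec [OF this] show ?thesis
    by (simp add: prod.distrib exp_sum [symmetric] sum_distrib_left)
qed

text \<open>The kernel is a product of unit-mass Gaussians of width \<delta>; half of the exponent
  in coordinate \<open>i\<close> is spent on absorbing the weight, which leaves a Gaussian of width
  \<open>sqrt 2 * \<delta>\<close>.\<close>

lemma gaussian_kernel_moment:
  fixes l :: "'n::finite \<Rightarrow> real"
  assumes "\<delta> > 0"
  shows "\<exists>I\<le>2 * \<delta>. has_bochner_integral lborel
    (\<lambda>\<xi> :: real ^ 'n. \<bar>\<xi> $ i - l i\<bar> * (\<Prod>j\<in>UNIV. exp (- (pi * ((\<xi> $ j - l j) / \<delta>)\<^sup>2)) / \<delta>)) I"
proof -
  let ?G = "\<lambda>\<xi> :: real ^ 'n. \<bar>\<xi> $ i - l i\<bar> * (\<Prod>j\<in>UNIV. exp (- (pi * ((\<xi> $ j - l j) / \<delta>)\<^sup>2)) / \<delta>)"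
  define g where "g j t = (if j = i then exp (- (pi * ((t - l j) / (sqrt 2 * \<delta>))\<^sup>2))
      else exp (- (pi * ((t - l j) / \<delta>)\<^sup>2)) / \<delta>)" for j t
  have "has_bochner_integral lborel (g j) (if j = i then sqrt 2 * \<delta> else 1)" for j
    using gaussian_integral [of "sqrt 2 * \<delta>" "l j"] assms
      has_bochner_integral_divide_zero [OF gaussian_integral [of \<delta> "l j"], of \<delta>]
    by (cases "j = i") (simp_all add: g_def [abs_def])
  from has_bochner_integral_prod_vec [of g "\<lambda>j. if j = i then sqrt 2 * \<delta> else 1", OF this]
  have g: "has_bochner_integral lborel (\<lambda>\<xi> :: real ^ 'n. \<Prod>j\<in>UNIV. g j (\<xi> $ j)) (sqrt 2 * \<delta>)"
    by simp
  have le: "?G \<xi> \<le> (\<Prod>j\<in>UNIV. g j (\<xi> $ j))" for \<xi>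
  proof -
    \<comment> \<open>In units of \<delta> the weight obeys \<open>\<bar>u\<bar> \<le> 1 + pi *
      u\<^sup>2 / 2 \<le> exp (pi * u\<^sup>2 / 2)\<close>.\<close>
    define u where "u = (\<xi> $ i - l i) / \<delta>"
    have "2 * \<bar>u\<bar> \<le> 1 + u\<^sup>2"
      using zero_le_power2 [of "\<bar>u\<bar> - 1"] by (simp add: power2_diff)
    moreover have "u\<^sup>2 * 2 \<le> u\<^sup>2 * pi" using pi_ge_two by (intro mult_left_mono) auto
    ultimately have "\<bar>u\<bar> \<le> 1 + pi * u\<^sup>2 / 2"
      using zero_le_power2 [of u] by (simp add: mult.commute)
    also have "\<dots> \<le> exp (pi * u\<^sup>2 / 2)" by (rule exp_ge_add_one_self)
    finally have u: "\<bar>u\<bar> * exp (- (pi * u\<^sup>2)) \<le> exp (pi * u\<^sup>2 / 2) * exp (- (pi * u\<^sup>2))"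
      by (intro mult_right_mono) auto
    have "((\<xi> $ i - l i) / (sqrt 2 * \<delta>))\<^sup>2 = u\<^sup>2 / 2"
      by (simp add: u_def power_divide power_mult_distrib)
    then have gi: "g i (\<xi> $ i) = exp (pi * u\<^sup>2 / 2) * exp (- (pi * u\<^sup>2))"
      by (simp add: g_def exp_add [symmetric])
    have "\<bar>\<xi> $ i - l i\<bar> * (exp (- (pi * ((\<xi> $ i - l i) / \<delta>)\<^sup>2)) / \<delta>) \<le> g i (\<xi> $ i)"
      using u assms unfolding gi u_def [symmetric] by (simp add: u_def abs_mult)
    moreover have "0 \<le> (\<Prod>j\<in>UNIV - {i}. exp (- (pi * ((\<xi> $ j - l j) / \<delta>)\<^sup>2)) / \<delta>)"
      using assms by (intro prod_nonneg) auto
    ultimately have "\<bar>\<xi> $ i - l i\<bar> * (exp (- (pi * ((\<xi> $ i - l i) / \<delta>)\<^sup>2)) / \<delta>)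
        * (\<Prod>j\<in>UNIV - {i}. exp (- (pi * ((\<xi> $ j - l j) / \<delta>)\<^sup>2)) / \<delta>)
      \<le> g i (\<xi> $ i) * (\<Prod>j\<in>UNIV - {i}. exp (- (pi * ((\<xi> $ j - l j) / \<delta>)\<^sup>2)) / \<delta>)"
      by (rule mult_right_mono)
    also have prod_g: "(\<Prod>j\<in>UNIV - {i}. exp (- (pi * ((\<xi> $ j - l j) / \<delta>)\<^sup>2)) / \<delta>) = (\<Prod>j\<in>UNIV - {i}. g j (\<xi> $ j))"
      by (intro prod.cong) (auto simp: g_def)
    finally have main: "\<bar>\<xi> $ i - l i\<bar> * (exp (- (pi * ((\<xi> $ i - l i) / \<delta>)\<^sup>2)) / \<delta>)
        * (\<Prod>j\<in>UNIV - {i}. g j (\<xi> $ j))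
      \<le> g i (\<xi> $ i) * (\<Prod>j\<in>UNIV - {i}. g j (\<xi> $ j))" .
    have "(\<Prod>j\<in>UNIV. exp (- (pi * ((\<xi> $ j - l j) / \<delta>)\<^sup>2)) / \<delta>)
        = exp (- (pi * ((\<xi> $ i - l i) / \<delta>)\<^sup>2)) / \<delta> * (\<Prod>j\<in>UNIV - {i}. g j (\<xi> $ j))"
      unfolding prod_g [symmetric] by (rule prod.remove) auto
    moreover have "(\<Prod>j\<in>UNIV. g j (\<xi> $ j)) = g i (\<xi> $ i) * (\<Prod>j\<in>UNIV - {i}. g j (\<xi> $ j))"
      by (rule prod.remove) auto
    ultimately show ?thesis using main by (simp only: mult.assoc)
  qed
  have nonneg: "0 \<le> ?G \<xi>" for \<xi>
    using assms by (intro mult_nonneg_nonneg prod_nonneg) auto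
  have int: "integrable lborel ?G"
  proof (rule Bochner_Integration.integrable_bound)
    show "integrable lborel (\<lambda>\<xi> :: real ^ 'n. \<Prod>j\<in>UNIV. g j (\<xi> $ j))"
      using g by (simp add: has_bochner_integral_iff)
    show "AE \<xi> in lborel. norm (?G \<xi>) \<le> norm (\<Prod>j\<in>UNIV. g j (\<xi> $ j))"
    proof (rule AE_I2)
      fix \<xi> :: "real ^ 'n"
      show "norm (?G \<xi>) \<le> norm (\<Prod>j\<in>UNIV. g j (\<xi> $ j))"
        unfolding real_norm_def abs_of_nonneg [OF nonneg]
        by (rule order_trans [OF le abs_ge_self])
    qed
  qed measurable
  have "integral\<^sup>L lborel ?G \<le> sqrt 2 * \<delta>"
    using integral_mono [OF int _ le] g by (simp add: has_bochner_integral_iff)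
  also have "\<dots> \<le> 2 * \<delta>"
    using assms sqrt2_less_2 by (intro mult_right_mono) auto
  finally show ?thesis using int by (auto simp: has_bochner_integral_iff)
qed

section \<open>Membership of the test functions in the Schwartz class\<close>

text \<open>Powers and sums are allowed so that derivatives stay in the class; membership in
  \<open>schwartz\<close> then only needs weighted bounds for its members.\<close>

inductive_set gaussian_polys :: "real \<Rightarrow> (real \<Rightarrow> complex) set" for \<delta> where
  base: "(\<lambda>x. c * of_real x ^ a * wave_packet \<delta> k x) \<in> gaussian_polys \<delta>"
| add: "\<lbrakk>f \<in> gaussian_polys \<delta>; g \<in> gaussian_polys \<delta>\<rbrakk> \<Longrightarrow> (\<lambda>x. f x + g x) \<in> gaussian_polys \<delta>"

lemma gaussian_polys_has_derivative:
  "f \<in> gaussian_polys \<delta> \<Longrightarrow> \<exists>f'\<in>gaussian_polys \<delta>. \<forall>x. (f has_vector_derivative f' x) (at x)"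
proof (induction rule: gaussian_polys.induct)
  case (base c a k)
  \<comment> \<open>\<open>P\<close> and \<open>Q\<close> write the packet as the exponential of a
    complex quadratic, so that it can be differentiated as a holomorphic function and restricted to
    the real line.\<close>
  define P Q :: complex where "P = of_real (- (2 * pi * \<delta>\<^sup>2))" and "Q = \<i> * of_real (2 * pi * k)"
  have wave: "wave_packet \<delta> k x = exp (P / 2 * (of_real x)\<^sup>2 + Q * of_real x)" for x
    unfolding wave_packet_def exp_of_real [symmetric] exp_add [symmetric]
    by (simp add: P_def Q_def power_mult_distrib mult_ac)
  \<comment> \<open>For \<open>a = 0\<close> the truncated exponent \<open>a - 1\<close> is
    harmless, its coefficient \<open>of_nat a\<close> being 0.\<close>
  let ?f' = "\<lambda>x. c * of_nat a * of_real x ^ (a - 1) * wave_packet \<delta> k x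
      + (c * P * of_real x ^ (a + 1) * wave_packet \<delta> k x + c * Q * of_real x ^ a * wave_packet \<delta> k x)"
  have "((\<lambda>x. c * of_real x ^ a * wave_packet \<delta> k x) has_vector_derivative ?f' x) (at x)" for x
  proof -
    have "((\<lambda>z. c * z ^ a * exp (P / 2 * z\<^sup>2 + Q * z)) has_field_derivative ?f' x) (at (of_real x))"
      unfolding wave
      by (rule derivative_eq_intros refl | simp)+ (simp add: algebra_simps)
    then show ?thesis unfolding wave by (rule has_vector_derivative_real_field)
  qed
  moreover have "?f' \<in> gaussian_polys \<delta>" by (intro gaussian_polys.intros)
  ultimately show ?case by (intro bexI [of _ ?f'] allI)
next
  case (add f g)
  then obtain f' g' where "f' \<in> gaussian_polys \<delta>" "g' \<in> gaussian_polys \<delta>"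
    "\<And>x. (f has_vector_derivative f' x) (at x)" "\<And>x. (g has_vector_derivative g' x) (at x)" by blast
  then show ?case
    by (intro bexI [of _ "\<lambda>x. f' x + g' x"]) (auto intro: derivative_intros gaussian_polys.intros)
qed

lemma power_le_fact_exp:
  fixes y :: real
  assumes "y \<ge> 0"
  shows "y ^ n \<le> fact n * exp y"
proof -
  have "(\<Sum>k\<in>{n}. y ^ k /\<^sub>R fact k) \<le> (\<Sum>k. y ^ k /\<^sub>R fact k)"
    using assms by (intro sum_le_suminf summable_exp_generic) auto
  then show ?thesis by (simp add: exp_def field_simps)
qed

text \<open>The power is traded for \<open>exp \<bar>x\<bar>\<close>, and
  \<open>\<bar>x\<bar>\<close> for the Gaussian exponent plus \<open>1 / \<delta>\<^sup>2\<close> by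
  the arithmetic-geometric mean inequality for \<open>\<delta> * \<bar>x\<bar>\<close> and
  \<open>1 / \<delta>\<close>.\<close>

lemma power_times_gaussian_le:
  assumes "\<delta> > 0"
  shows "\<bar>x\<bar> ^ n * exp (- (pi * (\<delta> * x)\<^sup>2)) \<le> fact n * exp (1 / \<delta>\<^sup>2)"
proof -
  have "\<bar>x\<bar> \<le> pi * (\<delta> * x)\<^sup>2 + 1 / \<delta>\<^sup>2"
  proof -
    have "2 * \<bar>x\<bar> \<le> (\<delta> * x)\<^sup>2 + 1 / \<delta>\<^sup>2"
      using zero_le_power2 [of "\<delta> * \<bar>x\<bar> - 1 / \<delta>"] assms
      by (simp add: power2_diff power_mult_distrib power_divide)
    moreover have "(\<delta> * x)\<^sup>2 * 1 \<le> (\<delta> * x)\<^sup>2 * pi" using pi_ge_two by (intro mult_left_mono) auto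
    ultimately show ?thesis by (simp add: mult.commute)
  qed
  then have "exp \<bar>x\<bar> * exp (- (pi * (\<delta> * x)\<^sup>2)) \<le> exp (1 / \<delta>\<^sup>2)"
    by (simp add: exp_add [symmetric])
  then have "fact n * (exp \<bar>x\<bar> * exp (- (pi * (\<delta> * x)\<^sup>2))) \<le> fact n * exp (1 / \<delta>\<^sup>2)"
    by (intro mult_left_mono) auto
  moreover have "\<bar>x\<bar> ^ n * exp (- (pi * (\<delta> * x)\<^sup>2)) \<le> fact n * exp \<bar>x\<bar> * exp (- (pi * (\<delta> * x)\<^sup>2))"
    by (intro mult_right_mono power_le_fact_exp) auto
  ultimately show ?thesis unfolding mult.assoc by linarith
qed

lemma gaussian_polys_bounded:
  assumes "\<delta> > 0" "f \<in> gaussian_polys \<delta>"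
  shows "bounded (range (\<lambda>x. x ^ l *\<^sub>R f x))"
  using assms(2)
proof (induction rule: gaussian_polys.induct)
  case (base c a k)
  have "cmod (x ^ l *\<^sub>R (c * of_real x ^ a * wave_packet \<delta> k x)) \<le> cmod c * (fact (l + a) * exp (1 / \<delta>\<^sup>2))" for x
  proof -
    have "cmod (x ^ l *\<^sub>R (c * of_real x ^ a * wave_packet \<delta> k x))
        = cmod c * (\<bar>x\<bar> ^ (l + a) * exp (- (pi * (\<delta> * x)\<^sup>2)))"
      by (simp add: norm_mult norm_power cmod_wave_packet power_add power_abs)
    also have "\<dots> \<le> cmod c * (fact (l + a) * exp (1 / \<delta>\<^sup>2))"
      by (intro mult_left_mono power_times_gaussian_le assms) auto
    finally show ?thesis .
  qed
  then show ?case by (auto simp: bounded_iff)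
next
  case (add f g)
  then show ?case
    using bounded_plus_comp [OF add.IH] by (simp add: scaleR_add_right)
qed

lemma gaussian_polys_schwartz:
  assumes "\<delta> > 0" "f \<in> gaussian_polys \<delta>"
  shows "f \<in> schwartz"
proof -
  have deriv: "(\<lambda>x. vector_derivative g (at x)) \<in> gaussian_polys \<delta>" "g differentiable (at x)"
    if "g \<in> gaussian_polys \<delta>" for g x
  proof -
    obtain g' where g': "g' \<in> gaussian_polys \<delta>" "\<And>x. (g has_vector_derivative g' x) (at x)"
      using gaussian_polys_has_derivative [OF \<open>g \<in> gaussian_polys \<delta>\<close>] by blast
    then have "(\<lambda>x. vector_derivative g (at x)) = g'"
      by (intro ext vector_derivative_at)
    with g' show "(\<lambda>x. vector_derivative g (at x)) \<in> gaussian_polys \<delta>" by simp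
    from g' show "g differentiable (at x)" by (blast intro: differentiableI_vector)
  qed
  have mem: "iterated_deriv k f \<in> gaussian_polys \<delta>" for k
    by (induction k) (auto simp: iterated_deriv_def assms intro: deriv)
  show ?thesis
    unfolding schwartz_def using mem deriv(2) gaussian_polys_bounded [OF assms(1)] by blast
qed

lemma sum_wave_packets_schwartz:
  assumes "\<delta> > 0" "finite I"
  shows "(\<lambda>x. \<Sum>k\<in>I. c k * wave_packet \<delta> (\<kappa> k) x) \<in> schwartz"
proof (rule gaussian_polys_schwartz [OF assms(1)])
  from assms(2) show "(\<lambda>x. \<Sum>k\<in>I. c k * wave_packet \<delta> (\<kappa> k) x) \<in> gaussian_polys \<delta>"
  proof (induction rule: finite_induct)
    case empty
    then show ?case using gaussian_polys.base [of 0 0 \<delta> 0] by simp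
  next
    case (insert i I)
    then show ?case using gaussian_polys.base [of "c i" 0 \<delta> "\<kappa> i"] by (auto intro: gaussian_polys.add)
  qed
qed

lemma fourier_sum_wave_packets:
  assumes "\<delta> > 0"
  shows "fourier (\<lambda>x. \<Sum>k\<in>I. c k * wave_packet \<delta> (\<kappa> k) x) \<xi>
    = (\<Sum>k\<in>I. c k * of_real (exp (- (pi * ((\<xi> - \<kappa> k) / \<delta>)\<^sup>2)) / \<delta>))"
proof -
  let ?e = "\<lambda>x. exp (- 2 * of_real pi * \<i> * of_real x * of_real \<xi>)"
  have "has_bochner_integral lebesgue (\<lambda>x. \<Sum>k\<in>I. c k * (wave_packet \<delta> (\<kappa> k) x * ?e x))
      (\<Sum>k\<in>I. c k * of_real (exp (- (pi * ((\<xi> - \<kappa> k) / \<delta>)\<^sup>2)) / \<delta>))"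
    by (intro has_bochner_integral_sum has_bochner_integral_mult_right wave_packet_transform assms)
  then show ?thesis
    unfolding fourier_def sum_distrib_right mult.assoc [of "c _"]
    by (rule has_bochner_integral_integral_eq)
qed

section \<open>Gaussian kernels as approximate identities\<close>

text \<open>The integrand of \<open>multiplier_op\<close> without the symbol, for wave packets with
  frequencies \<open>l\<close>.\<close>

definition gaussian_kernel :: "real \<Rightarrow> ('n::finite \<Rightarrow> real) \<Rightarrow> real \<Rightarrow> real ^ 'n \<Rightarrow> complex" where
  "gaussian_kernel \<delta> l x \<xi> =
     (\<Prod>j\<in>UNIV. of_real (exp (- (pi * ((\<xi> $ j - l j) / \<delta>)\<^sup>2)) / \<delta>)
        * exp (2 * of_real pi * \<i> * of_real x * of_real (\<xi> $ j)))"

lemma cmod_gaussian_kernel: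
  assumes "\<delta> > 0"
  shows "cmod (gaussian_kernel \<delta> l x \<xi>) = (\<Prod>j\<in>UNIV. exp (- (pi * ((\<xi> $ j - l j) / \<delta>)\<^sup>2)) / \<delta>)"
  using assms by (simp add: gaussian_kernel_def norm_mult prod_norm [symmetric] norm_divide)

lemma lipschitz_symbol_measurable:
  fixes m :: "real ^ 'n::finite \<Rightarrow> real"
  assumes "\<And>\<xi> \<eta>. \<bar>m \<xi> - m \<eta>\<bar> \<le> K * norm (\<xi> - \<eta>)"
  shows "m \<in> borel_measurable borel"
proof -
  have "K-lipschitz_on UNIV m"
  proof (rule lipschitz_onI)
    show "K \<ge> 0" using assms [of "axis undefined 1" 0] by (auto intro: order_trans [OF abs_ge_zero])
  qed (use assms in \<open>auto simp: dist_norm\<close>)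
  then show ?thesis
    by (intro borel_measurable_continuous_onI lipschitz_on_continuous_on)
qed

text \<open>The first moments of the kernel are O(\<delta>), so a Lipschitz symbol may be replaced
  by its value at \<open>l\<close>. The error bound is uniform in \<open>x\<close> and in the centre
  \<open>l\<close>; the bound \<open>M\<close> yields integrability.\<close>

lemma gaussian_kernel_approx_identity:
  fixes m :: "real ^ 'n::finite \<Rightarrow> real"
  assumes \<delta>: "\<delta> > 0" and lip: "\<And>\<xi> \<eta>. \<bar>m \<xi> - m \<eta>\<bar> \<le> K * norm (\<xi> - \<eta>)"
    and bd: "\<And>\<xi>. \<bar>m \<xi>\<bar> \<le> M"
  shows "integrable lebesgue (\<lambda>\<xi>. of_real (m \<xi>) * gaussian_kernel \<delta> l x \<xi>)"
    and "cmod ((LINT \<xi>|lebesgue. of_real (m \<xi>) * gaussian_kernel \<delta> l x \<xi>)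
        - of_real (m (\<chi> j. l j)) * (of_real (exp (- (pi * (\<delta> * x)\<^sup>2)) ^ CARD('n))
             * iexp (2 * pi * x * (\<Sum>j\<in>UNIV. l j))))
      \<le> 2 * K * CARD('n) * \<delta>"
proof -
  let ?m0 = "m (\<chi> j. l j)"
  let ?J = "of_real (exp (- (pi * (\<delta> * x)\<^sup>2)) ^ CARD('n)) * iexp (2 * pi * x * (\<Sum>j\<in>UNIV. l j))"
  let ?G = "gaussian_kernel \<delta> l x"
  have G: "has_bochner_integral lborel ?G ?J"
    unfolding gaussian_kernel_def [abs_def] by (rule gaussian_kernel_integral [OF \<delta>])
  have [measurable]: "m \<in> borel_measurable borel" by (rule lipschitz_symbol_measurable [OF lip])
  have K: "K \<ge> 0" using lip [of "axis undefined 1" 0] by (auto intro: order_trans [OF abs_ge_zero])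
  have [measurable]: "?G \<in> borel_measurable borel"
    using G by (auto simp: has_bochner_integral_iff dest: borel_measurable_integrable)
  have int: "integrable lborel (\<lambda>\<xi>. of_real (m \<xi>) * ?G \<xi>)"
  proof (rule Bochner_Integration.integrable_bound)
    show "integrable lborel (\<lambda>\<xi>. M *\<^sub>R ?G \<xi>)"
      using G by (intro integrable_scaleR_right) (auto simp: has_bochner_integral_iff)
    show "AE \<xi> in lborel. norm (of_real (m \<xi>) * ?G \<xi>) \<le> norm (M *\<^sub>R ?G \<xi>)"
    proof (rule AE_I2)
      fix \<xi>
      have "\<bar>m \<xi>\<bar> * cmod (?G \<xi>) \<le> \<bar>M\<bar> * cmod (?G \<xi>)"
        by (intro mult_right_mono order_trans [OF bd abs_ge_self]) simp
      then show "norm (of_real (m \<xi>) * ?G \<xi>) \<le> norm (M *\<^sub>R ?G \<xi>)"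
        by (simp only: norm_mult norm_of_real norm_scaleR)
    qed
  qed measurable
  then show "integrable lebesgue (\<lambda>\<xi>. of_real (m \<xi>) * ?G \<xi>)"
    by (subst integrable_completion) measurable
  have "\<forall>i. \<exists>I\<le>2 * \<delta>. has_bochner_integral lborel (\<lambda>\<xi> :: real ^ 'n. \<bar>\<xi> $ i - l i\<bar> * cmod (?G \<xi>)) I"
    unfolding cmod_gaussian_kernel [OF \<delta>] by (intro allI gaussian_kernel_moment \<delta>)
  from choice [OF this] obtain I where I: "I i \<le> 2 * \<delta>"
    "has_bochner_integral lborel (\<lambda>\<xi> :: real ^ 'n. \<bar>\<xi> $ i - l i\<bar> * cmod (?G \<xi>)) (I i)" for i
    by blast
  have sumI: "has_bochner_integral lborel
      (\<lambda>\<xi> :: real ^ 'n. K * (\<Sum>i\<in>UNIV. \<bar>\<xi> $ i - l i\<bar> * cmod (?G \<xi>))) (K * (\<Sum>i\<in>UNIV. I i))"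
    by (intro has_bochner_integral_mult_right has_bochner_integral_sum I)
  have diff: "has_bochner_integral lborel (\<lambda>\<xi>. of_real (m \<xi>) * ?G \<xi> - of_real ?m0 * ?G \<xi>)
      (integral\<^sup>L lborel (\<lambda>\<xi>. of_real (m \<xi>) * ?G \<xi>) - of_real ?m0 * ?J)"
    by (intro has_bochner_integral_diff has_bochner_integral_integrable int
        has_bochner_integral_mult_right G)
  have "cmod (integral\<^sup>L lborel (\<lambda>\<xi>. of_real (m \<xi>) * ?G \<xi>) - of_real ?m0 * ?J)
      = cmod (integral\<^sup>L lborel (\<lambda>\<xi>. of_real (m \<xi>) * ?G \<xi> - of_real ?m0 * ?G \<xi>))"
    using diff by (simp only: has_bochner_integral_iff)
  also have "\<dots> \<le> integral\<^sup>L lborel (\<lambda>\<xi> :: real ^ 'n. K * (\<Sum>i\<in>UNIV. \<bar>\<xi> $ i - l i\<bar> * cmod (?G \<xi>)))"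
  proof (rule Bochner_Integration.integral_norm_bound_integral)
    fix \<xi> :: "real ^ 'n"
    have "\<bar>m \<xi> - ?m0\<bar> \<le> K * (\<Sum>i\<in>UNIV. \<bar>\<xi> $ i - l i\<bar>)"
      using norm_le_l1_cart [of "\<xi> - (\<chi> j. l j)"] K
      by (intro order_trans [OF lip] mult_left_mono) auto
    then have "\<bar>m \<xi> - ?m0\<bar> * cmod (?G \<xi>) \<le> K * (\<Sum>i\<in>UNIV. \<bar>\<xi> $ i - l i\<bar>) * cmod (?G \<xi>)"
      by (intro mult_right_mono) auto
    moreover have "cmod (of_real (m \<xi>) * ?G \<xi> - of_real ?m0 * ?G \<xi>) = \<bar>m \<xi> - ?m0\<bar> * cmod (?G \<xi>)"
      by (simp only: left_diff_distrib [symmetric] of_real_diff [symmetric] norm_mult norm_of_real)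
    ultimately show "cmod (of_real (m \<xi>) * ?G \<xi> - of_real ?m0 * ?G \<xi>)
        \<le> K * (\<Sum>i\<in>UNIV. \<bar>\<xi> $ i - l i\<bar> * cmod (?G \<xi>))"
      by (simp add: sum_distrib_right mult.assoc)
  qed (use diff sumI in \<open>auto simp: has_bochner_integral_iff\<close>)
  also have "\<dots> = K * (\<Sum>i\<in>UNIV. I i)"
    using sumI by (simp add: has_bochner_integral_iff)
  also have "\<dots> \<le> K * (CARD('n) * (2 * \<delta>))"
    using K I(1) sum_mono [of UNIV I "\<lambda>_. 2 * \<delta>"] by (intro mult_left_mono) auto
  also have "integral\<^sup>L lborel (\<lambda>\<xi>. of_real (m \<xi>) * ?G \<xi>) = (LINT \<xi>|lebesgue. of_real (m \<xi>) * ?G \<xi>)"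
    by (rule integral_completion [symmetric]) measurable
  finally show "cmod ((LINT \<xi>|lebesgue. of_real (m \<xi>) * ?G \<xi>) - of_real ?m0 * ?J) \<le> 2 * K * CARD('n) * \<delta>"
    by (simp add: mult_ac)
qed

section \<open>Gaussian bounds for Lebesgue norms\<close>

text \<open>For finite \<open>p \<ge> 1\<close>, the \<open>p\<close>-th power of the Gaussian is at
  most the Gaussian itself, whose integral is \<open>1 / \<delta>\<close>. The constant is thus the
  same for all exponents, and \<open>p = \<infinity>\<close> fits in with exponent 0.\<close>

lemma Lp_norm_gaussian_le:
  assumes p: "1 \<le> p" and \<delta>: "\<delta> > 0" and K: "K \<ge> 0"
    and meas: "f \<in> borel_measurable borel"
    and le: "\<And>x. cmod (f x) \<le> K * exp (- (pi * (\<delta> * x)\<^sup>2))"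
  shows "Lp_norm p f \<le> ennreal (K * (1 / \<delta>) powr enn2real (inverse p))"
proof (cases "p = \<infinity>")
  case True
  have "f \<in> borel_measurable lborel" using meas by simp
  then have [measurable]: "f \<in> borel_measurable lebesgue" by (rule measurable_completion)
  have "cmod (f x) \<le> K" for x
  proof -
    have "K * exp (- (pi * (\<delta> * x)\<^sup>2)) \<le> K * 1"
      using K by (intro mult_left_mono) auto
    with le [of x] show ?thesis by simp
  qed
  then have "esssup lebesgue (\<lambda>x. ennreal (cmod (f x))) \<le> ennreal K"
    by (intro esssup_I AE_I2 ennreal_leI) measurable
  then show ?thesis using True \<delta> by (simp add: Lp_norm_def)
next
  case False
  define r where "r = enn2real p"
  have p_eq: "p = ennreal r" using False by (simp add: r_def less_top [symmetric])
  have r: "r \<ge> 1" using p unfolding p_eq by simp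
  have inv: "enn2real (inverse p) = 1 / r" using r by (simp add: p_eq inverse_ennreal inverse_eq_divide)
  define I where "I = (\<integral>\<^sup>+x. ennreal (cmod (f x) powr r) \<partial>lebesgue)"
  have "cmod (f x) powr r \<le> K powr r * exp (- (pi * ((x - 0) / (1 / \<delta>))\<^sup>2))" for x
  proof -
    have "cmod (f x) powr r \<le> (K * exp (- (pi * (\<delta> * x)\<^sup>2))) powr r"
      using r le by (intro powr_mono2) auto
    also have "\<dots> = K powr r * exp (- (r * (pi * (\<delta> * x)\<^sup>2)))"
      using K by (simp only: powr_mult exp_ge_zero) (simp add: powr_def)
    also have "\<dots> \<le> K powr r * exp (- (1 * (pi * (\<delta> * x)\<^sup>2)))"
      using r by (intro mult_left_mono iffD2 [OF exp_le_cancel_iff] le_imp_neg_le mult_right_mono) auto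
    finally show ?thesis by (simp add: mult.commute [of \<delta>])
  qed
  then have "I \<le> (\<integral>\<^sup>+x. ennreal (K powr r * exp (- (pi * ((x - 0) / (1 / \<delta>))\<^sup>2))) \<partial>lebesgue)"
    unfolding I_def by (intro nn_integral_mono ennreal_leI)
  also have "\<dots> = ennreal (K powr r * (1 / \<delta>))"
  proof -
    have "has_bochner_integral lebesgue (\<lambda>x. K powr r * exp (- (pi * ((x - 0) / (1 / \<delta>))\<^sup>2))) (K powr r * (1 / \<delta>))"
      using \<delta> by (intro has_bochner_integral_mult_right has_bochner_integral_completion gaussian_integral) auto
    then show ?thesis
      by (subst nn_integral_eq_integral) (auto simp: has_bochner_integral_iff)
  qed
  finally have I: "I \<le> ennreal (K powr r * (1 / \<delta>))" .
  then have fin: "I \<noteq> \<infinity>" by (auto simp: top_unique)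
  have "enn2real I \<le> K powr r * (1 / \<delta>)"
    using I \<delta> by (intro enn2real_leI) auto
  then have "enn2real I powr (1 / r) \<le> (K powr r * (1 / \<delta>)) powr (1 / r)"
    using r by (intro powr_mono2) auto
  also have "\<dots> = K * (1 / \<delta>) powr (1 / r)"
    using r K \<delta> by (subst powr_mult) (auto simp: powr_powr)
  finally show ?thesis
    using False fin by (simp add: Lp_norm_def Let_def r_def [symmetric] I_def [symmetric] inv ennreal_leI)
qed

text \<open>Only the interval of length \<open>2 / \<delta>\<close> about 0 is used, and the factor
  2 is dropped. The parameter is the reciprocal exponent \<sigma>, so target exponents below 1 and
  the case \<open>\<sigma> = 0\<close> are covered.\<close>

lemma Lp_norm_ge:
  assumes \<delta>: "\<delta> > 0" and h: "h \<ge> 0" and \<sigma>: "\<sigma> < \<infinity>"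
    and ge: "\<And>x. \<bar>x\<bar> \<le> 1 / \<delta> \<Longrightarrow> h \<le> cmod (f x)"
  shows "ennreal (h * (1 / \<delta>) powr enn2real \<sigma>) \<le> Lp_norm (inverse \<sigma>) f"
proof (cases "\<sigma> = 0")
  case True
  let ?e = "esssup lebesgue (\<lambda>x. ennreal (cmod (f x)))"
  have "ennreal h \<le> ?e"
  proof (rule ccontr)
    assume "\<not> ?thesis"
    then have less: "?e < ennreal h" by simp
    have "AE x in lebesgue. ennreal (cmod (f x)) \<le> ?e" by (rule esssup_AE)
    \<comment> \<open>Almost every point would then avoid the interval, which has positive
      length.\<close>
    then have "AE x in lebesgue. x \<notin> {- 1 / \<delta>..1 / \<delta>}"
    proof eventually_elim
      fix x assume x: "ennreal (cmod (f x)) \<le> ?e"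
      show "x \<notin> {- 1 / \<delta>..1 / \<delta>}"
      proof
        assume "x \<in> {- 1 / \<delta>..1 / \<delta>}"
        then have "ennreal h \<le> ennreal (cmod (f x))" by (intro ennreal_leI ge) auto
        then have "ennreal h \<le> ?e" using x by (rule order_trans)
        with less show False using leD by blast
      qed
    qed
    then have "emeasure lebesgue {x \<in> space lebesgue. \<not> x \<notin> {- 1 / \<delta>..1 / \<delta>}} = 0"
      by (subst AE_iff_measurable [symmetric, OF _ refl]) auto
    then have "emeasure lborel {- 1 / \<delta>..1 / \<delta>} = 0"
      by (simp add: atLeastAtMost_def atLeast_def atMost_def Collect_conj_eq [symmetric])
    then show False using \<delta> by (simp add: emeasure_lborel_Icc_eq split: if_splits)
  qed
  then show ?thesis using True \<delta> by (simp add: Lp_norm_def)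
next
  case False
  define t where "t = enn2real \<sigma>"
  have \<sigma>_eq: "\<sigma> = ennreal t" using \<sigma> by (simp add: t_def)
  have t: "t > 0" using False unfolding \<sigma>_eq by (simp add: ennreal_eq_0_iff)
  have inv: "inverse \<sigma> = ennreal (1 / t)" using t by (simp add: \<sigma>_eq inverse_ennreal inverse_eq_divide)
  define I where "I = (\<integral>\<^sup>+x. ennreal (cmod (f x) powr (1 / t)) \<partial>lebesgue)"
  have "ennreal (h powr (1 / t)) * emeasure lebesgue {- 1 / \<delta>..1 / \<delta>}
      = (\<integral>\<^sup>+x. ennreal (h powr (1 / t)) * indicator {- 1 / \<delta>..1 / \<delta>} x \<partial>lebesgue)"
    by (rule nn_integral_cmult_indicator [symmetric]) auto
  also have "\<dots> \<le> I"
    unfolding I_def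
  proof (rule nn_integral_mono)
    fix x
    show "ennreal (h powr (1 / t)) * indicator {- 1 / \<delta>..1 / \<delta>} x \<le> ennreal (cmod (f x) powr (1 / t))"
      using ge [of x] h t by (auto simp: indicator_def intro!: ennreal_leI powr_mono2)
  qed
  also have "emeasure lebesgue {- 1 / \<delta>..1 / \<delta>} = ennreal (2 / \<delta>)"
    using \<delta> by (simp add: emeasure_lborel_Icc_eq)
  finally have I: "ennreal (h powr (1 / t) * (2 / \<delta>)) \<le> I"
    by (subst ennreal_mult') auto
  show ?thesis
  proof (cases "I = \<infinity>")
    case True
    then show ?thesis using t by (simp add: Lp_norm_def Let_def inv I_def)
  next
    case False
    have "h powr (1 / t) * (1 / \<delta>) \<le> h powr (1 / t) * (2 / \<delta>)"
      using \<delta> by (intro mult_left_mono divide_right_mono) auto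
    also have "\<dots> \<le> enn2real I"
      using enn2real_mono [OF I] False \<delta> by (simp add: less_top)
    finally have "(h powr (1 / t) * (1 / \<delta>)) powr t \<le> enn2real I powr t"
      using t \<delta> by (intro powr_mono2) auto
    moreover have "(h powr (1 / t) * (1 / \<delta>)) powr t = h * (1 / \<delta>) powr t"
      using t h \<delta> by (subst powr_mult) (auto simp: powr_powr)
    ultimately have "ennreal (h * (1 / \<delta>) powr t) \<le> ennreal (enn2real I powr t)"
      by (intro ennreal_leI) simp
    then show ?thesis
      using t False by (simp add: Lp_norm_def Let_def inv t_def [symmetric] I_def [symmetric])
  qed
qed

section \<open>The counterexample\<close>

text \<open>Expanding the product of sums gives one term for each choice \<open>l\<close> of a
  frequency in every slot; integrability lets the finite sum leave the integral.\<close>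

lemma multiplier_op_sum_wave_packets:
  fixes m :: "real ^ 'n::finite \<Rightarrow> real"
  assumes \<delta>: "\<delta> > 0" and I: "finite I"
    and int: "\<And>l. integrable lebesgue (\<lambda>\<xi>. of_real (m \<xi>) * gaussian_kernel \<delta> l x \<xi>)"
  shows "multiplier_op m (\<lambda>_ x. \<Sum>k\<in>I. c k * wave_packet \<delta> (\<kappa> k) x) x
    = (\<Sum>l\<in>UNIV \<rightarrow>\<^sub>E I. (\<Prod>j\<in>UNIV. c (l j)) *
        (LINT \<xi>|lebesgue. of_real (m \<xi>) * gaussian_kernel \<delta> (\<lambda>j. \<kappa> (l j)) x \<xi>))"
proof -
  let ?g = "\<lambda>k t. complex_of_real (exp (- (pi * ((t - \<kappa> k) / \<delta>)\<^sup>2)) / \<delta>)"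
  let ?e = "\<lambda>t. exp (2 * of_real pi * \<i> * of_real x * of_real t)"
  have "(\<Prod>j\<in>UNIV. (\<Sum>k\<in>I. c k * ?g k (\<xi> $ j)) * ?e (\<xi> $ j))
      = (\<Sum>l\<in>UNIV \<rightarrow>\<^sub>E I. (\<Prod>j\<in>UNIV. c (l j)) * gaussian_kernel \<delta> (\<lambda>j. \<kappa> (l j)) x \<xi>)"
    for \<xi> :: "real ^ 'n"
    unfolding sum_distrib_right using I
    by (subst prod_sum_PiE) (simp_all only: gaussian_kernel_def prod.distrib mult.assoc finite)
  then have "multiplier_op m (\<lambda>_ x. \<Sum>k\<in>I. c k * wave_packet \<delta> (\<kappa> k) x) x
      = (LINT \<xi>|lebesgue. (\<Sum>l\<in>UNIV \<rightarrow>\<^sub>E I. (\<Prod>j\<in>UNIV. c (l j)) *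
          (of_real (m \<xi>) * gaussian_kernel \<delta> (\<lambda>j. \<kappa> (l j)) x \<xi>)))"
    unfolding multiplier_op_def fourier_sum_wave_packets [OF \<delta>]
    by (simp only: sum_distrib_left mult.left_commute)
  also have "\<dots> = (\<Sum>l\<in>UNIV \<rightarrow>\<^sub>E I. (LINT \<xi>|lebesgue. (\<Prod>j\<in>UNIV. c (l j)) *
          (of_real (m \<xi>) * gaussian_kernel \<delta> (\<lambda>j. \<kappa> (l j)) x \<xi>)))"
    by (intro Bochner_Integration.integral_sum integrable_mult_right int)
  finally show ?thesis by simp
qed

section \<open>Test functions and the signs of the symbol\<close>

definition rudin_shapiro_packet :: "real \<Rightarrow> nat \<Rightarrow> real \<Rightarrow> complex" where
  "rudin_shapiro_packet \<delta> m x =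
     (\<Sum>k | \<bar>k\<bar> < 2 ^ m. of_real (rudin_shapiro (nat \<bar>k\<bar>)) * wave_packet \<delta> (of_int k) x)"

text \<open>The Gaussian factors out, and what remains is the two-sided Rudin-Shapiro sum at the
  point \<open>cis (2 * pi * x)\<close> of the unit circle.\<close>

lemma cmod_rudin_shapiro_packet_le:
  "cmod (rudin_shapiro_packet \<delta> m x) \<le> 4 * sqrt (2 ^ m) * exp (- (pi * (\<delta> * x)\<^sup>2))"
proof -
  have "iexp (2 * pi * of_int k * x) = cis (2 * pi * x) powi k" for k :: int
    unfolding cis_power_int by (simp add: cis_conv_exp mult_ac)
  then have "rudin_shapiro_packet \<delta> m x = of_real (exp (- (pi * (\<delta> * x)\<^sup>2))) *
      (\<Sum>k | \<bar>k\<bar> < 2 ^ m. of_real (rudin_shapiro (nat \<bar>k\<bar>)) * cis (2 * pi * x) powi k)"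
    by (simp only: rudin_shapiro_packet_def wave_packet_def sum_distrib_left mult.left_commute)
  then have "cmod (rudin_shapiro_packet \<delta> m x) = exp (- (pi * (\<delta> * x)\<^sup>2)) *
      cmod (\<Sum>k | \<bar>k\<bar> < 2 ^ m. of_real (rudin_shapiro (nat \<bar>k\<bar>)) * cis (2 * pi * x) powi k)"
    by (simp add: norm_mult)
  also have "\<dots> \<le> exp (- (pi * (\<delta> * x)\<^sup>2)) * (4 * sqrt (2 ^ m))"
    by (intro mult_left_mono cmod_symmetric_rudin_shapiro_le) auto
  finally show ?thesis by (simp add: mult_ac)
qed

lemma finite_int_abs_less: "finite {k::int. \<bar>k\<bar> < N}"
  by (rule finite_subset [of _ "{- N..N}"]) auto

lemma rudin_shapiro_packet_schwartz:
  assumes "\<delta> > 0"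
  shows "rudin_shapiro_packet \<delta> m \<in> schwartz"
  unfolding rudin_shapiro_packet_def [abs_def]
  by (intro sum_wave_packets_schwartz assms finite_int_abs_less)

lemma rudin_shapiro_packet_measurable: "rudin_shapiro_packet \<delta> m \<in> borel_measurable borel"
  unfolding rudin_shapiro_packet_def [abs_def] wave_packet_def by measurable

definition small_lattice_points :: "real ^ 'n::finite \<Rightarrow> ('n \<Rightarrow> int) set" where
  "small_lattice_points \<alpha> =
     {k. (\<Sum>j\<in>UNIV. k j) = 0 \<and> \<bar>\<Sum>j\<in>UNIV. \<alpha> $ j * of_int (k j)\<bar> \<le> 1}"

definition rudin_shapiro_coeff :: "real ^ 'n::finite \<Rightarrow> ('n \<Rightarrow> int) \<Rightarrow> real" where
  "rudin_shapiro_coeff \<alpha> k =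
     (if k \<in> small_lattice_points \<alpha> then \<Prod>j\<in>UNIV. rudin_shapiro (nat \<bar>k j\<bar>) else 0)"

lemma abs_rudin_shapiro_coeff_le: "\<bar>rudin_shapiro_coeff \<alpha> k\<bar> \<le> 1"
  by (simp add: rudin_shapiro_coeff_def abs_prod)

context smooth_bump
begin

text \<open>At a small lattice point the sign of the symbol cancels the signs of the test functions, and the
  output frequency \<open>\<Sum>\<^sub>j k j\<close> is zero, so all these contributions add up coherently. The error terms
  vanish as \<open>\<delta> \<rightarrow> 0\<close> for fixed \<open>m\<close>, with \<open>\<delta>\<close> chosen after \<open>m\<close>.\<close>

lemma rudin_shapiro_multiplier_ge:
  fixes \<alpha> :: "real ^ 'n::finite"
  defines "c \<equiv> exp (- pi) ^ CARD('n) * B 0 0 ^ CARD('n) / 2"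
  shows "\<exists>\<delta>>0. \<forall>x. \<bar>x\<bar> \<le> 1 / \<delta> \<longrightarrow>
    c * card {k \<in> small_lattice_points \<alpha>. \<forall>j. \<bar>k j\<bar> < 2 ^ m}
      \<le> cmod (multiplier_op (lattice_bump (rudin_shapiro_coeff \<alpha>) (\<lambda>_. 0))
                (\<lambda>_. rudin_shapiro_packet \<delta> m) x)"
proof -
  let ?A = "rudin_shapiro_coeff \<alpha>"
  let ?m = "lattice_bump ?A (\<lambda>_. 0)"
  let ?n = "CARD('n)"
  let ?D = "{k \<in> small_lattice_points \<alpha>. \<forall>j. \<bar>k j\<bar> < 2 ^ m}"
  define S where "S = (UNIV :: 'n set) \<rightarrow>\<^sub>E {k::int. \<bar>k\<bar> < 2 ^ m}"
  define r where "r l = (\<Prod>j\<in>UNIV. rudin_shapiro (nat \<bar>l j\<bar>))" for l :: "'n \<Rightarrow> int"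
  define b where "b = B 0 0 ^ ?n"
  have b: "b > 0" using B_pos by (simp add: b_def)
  have S: "finite S" "?D = S \<inter> small_lattice_points \<alpha>"
    by (auto simp: S_def finite_PiE finite_int_abs_less)
  have r: "r l * r l = 1" "\<bar>r l\<bar> = 1" for l
    by (simp_all add: r_def prod.distrib [symmetric] abs_prod)
  obtain K where K: "K > 0" "\<And>\<xi> \<eta>. \<bar>?m \<xi> - ?m \<eta>\<bar> \<le> K * norm (\<xi> - \<eta>)"
    using lattice_bump_lipschitz [of ?A "\<lambda>_. 0", OF abs_rudin_shapiro_coeff_le] by blast
  obtain M where M: "\<And>\<xi>. \<bar>?m \<xi>\<bar> \<le> M"
    using lattice_bump_bounded [of "\<lambda>_. 0"] abs_rudin_shapiro_coeff_le by blast
  show ?thesis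
  proof (cases "?D = {}")
    case True
    \<comment> \<open>Without admissible points the left side is 0. In the other case a count of at
      least 1 lets the error be compared with the main term.\<close>
    show ?thesis unfolding True by (intro exI [of _ 1]) simp
  next
    case False
    then have D: "real (card ?D) \<ge> 1"
      using S by (simp add: Suc_le_eq card_gt_0_iff)
    \<comment> \<open>\<open>\<epsilon> * \<delta>\<close> bounds the total error of the terms in
      \<open>S\<close>, the added 1 making positivity immediate. The choice of \<delta> as
      \<open>c / \<epsilon>\<close> makes it equal to \<open>c\<close>.\<close>
    define \<epsilon> where "\<epsilon> = 2 * K * ?n * (card S + 1)"
    have \<epsilon>: "\<epsilon> > 0" using K by (simp add: \<epsilon>_def)
    have c: "c > 0" using b by (simp add: c_def b_def)
    define \<delta> where "\<delta> = c / \<epsilon>"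
    have \<delta>: "\<delta> > 0" using c \<epsilon> by (simp add: \<delta>_def)
    have "c * card ?D \<le> cmod (multiplier_op ?m (\<lambda>_. rudin_shapiro_packet \<delta> m) x)"
      if x: "\<bar>x\<bar> \<le> 1 / \<delta>" for x
    proof -
      define E where "E = exp (- (pi * (\<delta> * x)\<^sup>2)) ^ ?n"
      define J where "J l = complex_of_real E * iexp (2 * pi * x * (\<Sum>j\<in>UNIV. of_int (l j)))"
        for l :: "'n \<Rightarrow> int"
      define T where "T l = (LINT \<xi>|lebesgue. of_real (?m \<xi>) * gaussian_kernel \<delta> (\<lambda>j. of_int (l j)) x \<xi>)"
        for l :: "'n \<Rightarrow> int"
      have op: "multiplier_op ?m (\<lambda>_. rudin_shapiro_packet \<delta> m) x = (\<Sum>l\<in>S. of_real (r l) * T l)"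
        unfolding rudin_shapiro_packet_def [abs_def] S_def T_def r_def of_real_prod
        by (rule multiplier_op_sum_wave_packets
            [OF \<delta> finite_int_abs_less gaussian_kernel_approx_identity(1) [OF \<delta> K(2) M]])
      have T: "cmod (T l - of_real (?A l * b) * J l) \<le> 2 * K * ?n * \<delta>" for l
        using gaussian_kernel_approx_identity(2) [OF \<delta> K(2) M, of "\<lambda>j. of_int (l j)" x]
        unfolding T_def J_def E_def b_def lattice_bump_at_lattice by simp
      have main: "(\<Sum>l\<in>S. of_real (r l) * (of_real (?A l * b) * J l)) = of_real (card ?D * (b * E))"
      proof -
        have "of_real (r l) * (of_real (?A l * b) * J l)
            = (if l \<in> small_lattice_points \<alpha> then of_real (b * E) else 0)" for l
        proof (cases "l \<in> small_lattice_points \<alpha>")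
          case True
          then have "(\<Sum>j\<in>UNIV. real_of_int (l j)) = 0"
            unfolding of_int_sum [symmetric] by (simp add: small_lattice_points_def)
          then have "of_real (r l) * (of_real (?A l * b) * J l) = of_real (r l * r l * (b * E))"
            using True by (simp add: J_def rudin_shapiro_coeff_def r_def [symmetric])
          with True show ?thesis by (simp add: r)
        qed (simp add: rudin_shapiro_coeff_def)
        then show ?thesis
          using S by (simp add: sum.inter_restrict [symmetric])
      qed
      have "cmod ((\<Sum>l\<in>S. of_real (r l) * T l) - of_real (card ?D * (b * E)))
          = cmod (\<Sum>l\<in>S. of_real (r l) * (T l - of_real (?A l * b) * J l))"
        unfolding main [symmetric] by (simp only: right_diff_distrib sum_subtractf)
      also have "\<dots> \<le> (\<Sum>l\<in>S. 2 * K * ?n * \<delta>)"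
        by (rule sum_norm_le) (use T r in \<open>simp add: norm_mult\<close>)
      also have "\<dots> \<le> \<epsilon> * \<delta>"
        using K \<delta> by (simp add: \<epsilon>_def algebra_simps)
      also have "\<dots> = c" using \<epsilon> by (simp add: \<delta>_def)
      also have "\<dots> \<le> c * card ?D" using c D by simp
      finally have err: "cmod ((\<Sum>l\<in>S. of_real (r l) * T l) - of_real (card ?D * (b * E)))
          \<le> c * card ?D" .
      have "\<bar>\<delta> * x\<bar> \<le> 1" using x \<delta> by (simp add: abs_mult field_simps)
      then have "(\<delta> * x)\<^sup>2 \<le> 1" by (simp add: abs_square_le_1)
      \<comment> \<open>Each Gaussian factor is at least \<open>exp (- pi)\<close> for these
        \<open>x\<close>. The main term is hence at least \<open>2 * (c * card ?D)\<close>, and the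
        half built into \<open>c\<close> pays for the error.\<close>
      then have "exp (- pi) ^ ?n \<le> E"
        unfolding E_def by (intro power_mono) (auto simp: mult_left_le)
      then have "card ?D * (b * exp (- pi) ^ ?n) \<le> card ?D * (b * E)"
        using b by (intro mult_left_mono) auto
      moreover have "card ?D * (b * exp (- pi) ^ ?n) = 2 * (c * card ?D)"
        by (simp add: c_def b_def)
      moreover have "card ?D * (b * E) \<le> cmod (of_real (card ?D * (b * E)))"
        unfolding norm_of_real by (rule abs_ge_self)
      moreover have "cmod (of_real (card ?D * (b * E))) - cmod (\<Sum>l\<in>S. of_real (r l) * T l)
          \<le> cmod ((\<Sum>l\<in>S. of_real (r l) * T l) - of_real (card ?D * (b * E)))"
        by (subst norm_minus_commute) (rule norm_triangle_ineq2)
      ultimately show ?thesis using err unfolding op by linarith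
    qed
    with \<delta> show ?thesis by blast
  qed
qed

lemma rudin_shapiro_multiplier_no_Lp_estimates:
  fixes \<alpha> :: "real ^ 'n::finite"
  assumes n: "CARD('n) \<ge> 5"
  shows "satisfies_no_Lp_estimates (multiplier_op (lattice_bump (rudin_shapiro_coeff \<alpha>) (\<lambda>_. 0)))"
  unfolding satisfies_no_Lp_estimates_def
proof (intro notI, elim exE conjE)
  let ?T = "multiplier_op (lattice_bump (rudin_shapiro_coeff \<alpha>) (\<lambda>_. 0))"
  let ?n = "CARD('n)"
  fix p :: "'n \<Rightarrow> ennreal" and C :: real
  assume p: "\<forall>j. 1 \<le> p j"
    and est: "\<forall>f. (\<forall>j. f j \<in> schwartz) \<longrightarrow>
      Lp_norm (inverse (\<Sum>j\<in>UNIV. inverse (p j))) (?T f) \<le> ennreal C * (\<Prod>j\<in>UNIV. Lp_norm (p j) (f j))"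
  \<comment> \<open>A constant of at least 1 keeps the right side non-negative also when
    \<open>C\<close> is negative.\<close>
  define C' where "C' = max C 1"
  define \<sigma> where "\<sigma> = (\<Sum>j\<in>UNIV. inverse (p j))"
  \<comment> \<open>As \<open>p j \<ge> 1\<close>, every reciprocal is finite, so the reciprocals
    may be added as real numbers, with 0 from an infinite \<open>p j\<close>.\<close>
  have inv_fin: "inverse (p j) < \<infinity>" for j
    using p [rule_format, of j] by (auto simp: less_top [symmetric] ennreal_inverse_eq_top_iff)
  then have \<sigma>: "\<sigma> < \<infinity>" by (simp add: \<sigma>_def)
  have \<sigma>_real: "enn2real \<sigma> = (\<Sum>j\<in>UNIV. enn2real (inverse (p j)))"
    unfolding \<sigma>_def using enn2real_sum [of UNIV "\<lambda>j. inverse (p j)"] inv_fin by simp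
  define c where "c = exp (- pi) ^ ?n * B 0 0 ^ ?n / 2"
  have c: "c > 0" using B_pos by (simp add: c_def)
  obtain c' :: real where c': "c' > 0" "\<And>N::nat. N > 0 \<Longrightarrow> c' * real N ^ ?n \<le> real N ^ 2 *
       real (card {k::'n \<Rightarrow> int. (\<forall>j. \<bar>k j\<bar> < int N) \<and> (\<Sum>j\<in>UNIV. k j) = 0 \<and>
                     \<bar>\<Sum>j\<in>UNIV. \<alpha> $ j * of_int (k j)\<bar> \<le> 1})"
    using card_small_lattice_points [of \<alpha>] by blast
  \<comment> \<open>Let n be the dimension and \<open>s = sqrt (2 ^ m)\<close>. The inputs
    contribute \<open>(4 * s) ^ n\<close>, while the count is at least
    \<open>c' * s ^ (2 * n - 4)\<close>; so \<open>s ^ (n - 4)\<close>, and with it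
    \<open>s\<close>, would be bounded independently of \<open>m\<close>.\<close>
  have bound: "c * c' * sqrt (2 ^ m) \<le> C' * 4 ^ ?n" for m
  proof -
    define s :: real where "s = sqrt (2 ^ m)"
    have s: "s \<ge> 1" "s ^ 2 = 2 ^ m" by (simp_all add: s_def)
    let ?D = "real (card {k \<in> small_lattice_points \<alpha>. \<forall>j. \<bar>k j\<bar> < 2 ^ m})"
    obtain \<delta> where \<delta>: "\<delta> > 0" and
      ge: "\<And>x. \<bar>x\<bar> \<le> 1 / \<delta> \<Longrightarrow> c * ?D \<le> cmod (?T (\<lambda>_. rudin_shapiro_packet \<delta> m) x)"
      using rudin_shapiro_multiplier_ge [of \<alpha> m] unfolding c_def by blast
    \<comment> \<open>The width factor of the output. The exponents of the inputs add up to that of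
      the output, so the same \<open>w\<close> appears on both sides and cancels.\<close>
    define w where "w = (1 / \<delta>) powr enn2real \<sigma>"
    have w: "w > 0" using \<delta> by (simp add: w_def)
    have w_prod: "w = (\<Prod>j\<in>UNIV. (1 / \<delta>) powr enn2real (inverse (p j)))"
      using \<delta> by (simp add: w_def \<sigma>_real powr_sum)
    have "ennreal (c * ?D * w) \<le> Lp_norm (inverse \<sigma>) (?T (\<lambda>_. rudin_shapiro_packet \<delta> m))"
      unfolding w_def
      by (rule Lp_norm_ge [OF \<delta> _ \<sigma> ge]) (use c in auto)
    also have "\<dots> \<le> ennreal C * (\<Prod>j\<in>UNIV. Lp_norm (p j) (rudin_shapiro_packet \<delta> m))"
      unfolding \<sigma>_def
      by (rule est [rule_format, of "\<lambda>_. rudin_shapiro_packet \<delta> m"])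
        (rule rudin_shapiro_packet_schwartz [OF \<delta>])
    also have "\<dots> \<le> ennreal C' * (\<Prod>j\<in>UNIV. ennreal (4 * s * (1 / \<delta>) powr enn2real (inverse (p j))))"
      unfolding C'_def s_def
      by (intro mult_mono prod_mono_ennreal ennreal_leI Lp_norm_gaussian_le p [rule_format] \<delta>
          rudin_shapiro_packet_measurable cmod_rudin_shapiro_packet_le) auto
    also have "\<dots> = ennreal (C' * ((4 * s) ^ ?n * w))"
    proof -
      have "(\<Prod>j\<in>UNIV. ennreal (4 * s * (1 / \<delta>) powr enn2real (inverse (p j)))) = ennreal ((4 * s) ^ ?n * w)"
        using s by (subst prod_ennreal) (simp_all add: prod.distrib w_prod)
      then show ?thesis using s w by (simp add: C'_def ennreal_mult)
    qed
    finally have "c * ?D * w \<le> C' * ((4 * s) ^ ?n * w)"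
      using s w by (subst (asm) ennreal_le_iff) (auto simp: C'_def)
    then have "c * ?D \<le> C' * (4 * s) ^ ?n"
      using w by (simp add: mult.assoc [symmetric])
    moreover have "c' * (s\<^sup>2) ^ ?n \<le> (s\<^sup>2)\<^sup>2 * ?D"
      using c'(2) [of "2 ^ m"] by (simp add: s small_lattice_points_def conj_ac)
    ultimately have "c * (c' * (s\<^sup>2) ^ ?n) \<le> (s\<^sup>2)\<^sup>2 * (C' * (4 * s) ^ ?n)"
    proof -
      assume 1: "c * ?D \<le> C' * (4 * s) ^ ?n" and 2: "c' * (s\<^sup>2) ^ ?n \<le> (s\<^sup>2)\<^sup>2 * ?D"
      have "c * (c' * (s\<^sup>2) ^ ?n) \<le> c * ((s\<^sup>2)\<^sup>2 * ?D)"
        using c by (intro mult_left_mono 2) auto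
      also have "\<dots> = (s\<^sup>2)\<^sup>2 * (c * ?D)" by (simp only: mult_ac)
      also have "\<dots> \<le> (s\<^sup>2)\<^sup>2 * (C' * (4 * s) ^ ?n)" by (intro mult_left_mono 1) auto
      finally show ?thesis .
    qed
    also have "(s\<^sup>2) ^ ?n = s ^ ?n * s ^ ?n"
      by (simp only: power2_eq_square power_mult_distrib)
    also have "(s\<^sup>2)\<^sup>2 * (C' * (4 * s) ^ ?n) = s ^ 4 * (C' * 4 ^ ?n) * s ^ ?n"
      by (simp add: power_mult_distrib mult_ac flip: power_mult)
    finally have "c * c' * s ^ ?n * s ^ ?n \<le> s ^ 4 * (C' * 4 ^ ?n) * s ^ ?n"
      by (simp only: mult_ac)
    then have "c * c' * s ^ ?n \<le> s ^ 4 * (C' * 4 ^ ?n)"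
      using s by simp
    \<comment> \<open>Here the dimension enters: with \<open>s \<ge> 1\<close>, at least five
      coordinates leave one factor \<open>s\<close> beyond \<open>s ^ 4\<close>.\<close>
    moreover have "c * c' * s ^ 5 \<le> c * c' * s ^ ?n"
      using c c' s n by (intro mult_left_mono power_increasing) auto
    ultimately have "s ^ 4 * (c * c' * s) \<le> s ^ 4 * (C' * 4 ^ ?n)"
      by (simp add: eval_nat_numeral mult_ac)
    then show ?thesis using s by (simp add: s_def)
  qed
  obtain m where m: "(C' * 4 ^ ?n / (c * c'))\<^sup>2 < 2 ^ m"
    using real_arch_pow [of 2] by auto
  have "C' * 4 ^ ?n / (c * c') < sqrt (2 ^ m)"
    using m by (rule real_less_rsqrt)
  then have "C' * 4 ^ ?n < c * c' * sqrt (2 ^ m)"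
    using c c' by (simp add: pos_divide_less_eq mult_ac)
  with bound [of m] show False by simp
qed

end

theorem theorem4:
  fixes \<alpha> :: "real ^ 'n::finite" and a :: real and q :: "'n \<Rightarrow> rat"
  assumes "CARD('n) \<ge> 5"
    and "\<And>j. inverse (\<alpha> $ j) = of_rat (q j) + a * (of_rat (q j))\<^sup>2"
    and "inj q"
    and "\<And>j. q j \<noteq> 0"
    and "\<And>j. of_rat (q j) * a \<noteq> -1"
  defines "\<Gamma> \<equiv> {\<xi> :: real ^ 'n. (\<Sum>j\<in>UNIV. \<xi> $ j * \<alpha> $ j) = 0}"
  shows "\<exists>m \<in> adapted_multipliers \<Gamma>.
           (\<exists>C. \<forall>\<xi>. m \<xi> \<noteq> 0 \<longrightarrow> infdist \<xi> \<Gamma> \<le> C) \<and>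
           satisfies_no_Lp_estimates (multiplier_op m)"
proof -
  obtain B where "smooth_bump B" using smooth_bump_exists by blast
  then interpret smooth_bump B .
  obtain i :: 'n where True by simp
  \<comment> \<open>Both factors are non-zero; since \<open>inverse 0 = 0\<close>, this gives
    \<open>\<alpha> $ i \<noteq> 0\<close>, so the linear form controls the distance to the
    hyperplane.\<close>
  have "inverse (\<alpha> $ i) = of_rat (q i) * (1 + of_rat (q i) * a)"
    using assms(2) [of i] by (simp add: algebra_simps power2_eq_square)
  moreover have "1 + of_rat (q i) * a \<noteq> 0" using assms(5) [of i] by (metis add.commute add_eq_0_iff2)
  ultimately have "inverse (\<alpha> $ i) \<noteq> 0" using assms(4) [of i] by simp
  then have i: "\<alpha> $ i \<noteq> 0" by auto
  have supp: "\<bar>\<Sum>j\<in>UNIV. \<alpha> $ j * of_int (k j)\<bar> \<le> 1" if "rudin_shapiro_coeff \<alpha> k \<noteq> 0" for k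
    using that by (auto simp: rudin_shapiro_coeff_def small_lattice_points_def split: if_splits)
  show ?thesis
  proof (intro bexI conjI)
    show "lattice_bump (rudin_shapiro_coeff \<alpha>) (\<lambda>_. 0) \<in> adapted_multipliers \<Gamma>"
      unfolding \<Gamma>_def by (rule lattice_bump_adapted [OF i abs_rudin_shapiro_coeff_le supp])
    show "\<exists>C. \<forall>\<xi>. lattice_bump (rudin_shapiro_coeff \<alpha>) (\<lambda>_. 0) \<xi> \<noteq> 0 \<longrightarrow> infdist \<xi> \<Gamma> \<le> C"
      using lattice_bump_support [OF i supp] unfolding \<Gamma>_def by blast
    show "satisfies_no_Lp_estimates (multiplier_op (lattice_bump (rudin_shapiro_coeff \<alpha>) (\<lambda>_. 0)))"
      by (rule rudin_shapiro_multiplier_no_Lp_estimates [OF assms(1)])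
  qed
qed

end
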